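(* Let $t\leq 6$ be a positive integer. Then for any prime $p$ the field $\mathbb{Z}_p$ (viewed as an additive group) is $t$-weak sequenceable; that is, every subset $A\subseteq \mathbb{Z}_p\setminus\{0\}$ with $|A|>t$ is $t$-weak sequenceable.
   Context: Let $G$ be an abelian group, $t$ a positive integer, and $A\subseteq G\setminus\{0\}$ a finite subset with $k=|A|>t$. For an ordering $(a_1,\ldots,a_k)$ of the elements of $A$ (each element listed exactly once), the partial sums are $s_0=0$ and $s_i=a_1+\cdots+a_i$ for $1\leq i\leq k$. The ordering is a $t$-weak sequencing of $A$ if $s_i\neq s_j$ for all $i,j\in\{0,1,\ldots,k\}$ with $i\neq j$ and $|i-j|\leq t$. The set $A$ is $t$-weak sequenceable if it admits a $t$-weak sequencing. The group $G$ is $t$-weak sequenceable if every subset of $G\setminus\{0\}$ of size bigger than $t$ is $t$-weak sequenceable. *)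

theory Defs
  imports "HOL-Algebra.FiniteProduct" "HOL-Algebra.Elementary_Groups" "HOL-Computational_Algebra.Primes"
begin

text \<open>
  Abelian groups are taken in HOL-Algebra's multiplicative notation, so the sums
  of the additive theory appear as products and \<open>0\<close> as \<open>\<one>\<close>.
\<close>

text \<open>
  Lists are indexed from 0: the ordering \<open>(a\<^sub>1, \<dots>, a\<^sub>k)\<close> is the list \<open>as\<close> with
  \<open>a\<^sub>i = as ! (i - 1)\<close>, so \<open>partial_sum G as i\<close> is \<open>s\<^sub>i = a\<^sub>1 + \<dots> + a\<^sub>i\<close>, and \<open>s\<^sub>0 = 0\<close>.
\<close>

definition partial_sum :: "('a, 'b) monoid_scheme \<Rightarrow> 'a list \<Rightarrow> nat \<Rightarrow> 'a" where
  "partial_sum G as i = (\<Otimes>\<^bsub>G\<^esub>j\<in>{..<i}. as ! j)"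

definition weak_sequencing ::
    "('a, 'b) monoid_scheme \<Rightarrow> nat \<Rightarrow> 'a set \<Rightarrow> 'a list \<Rightarrow> bool" where
  "weak_sequencing G t A as \<longleftrightarrow>
     distinct as \<and> set as = A \<and>
     (\<forall>i\<in>{0..card A}. \<forall>j\<in>{0..card A}.
        i \<noteq> j \<and> \<bar>int i - int j\<bar> \<le> int t \<longrightarrow> partial_sum G as i \<noteq> partial_sum G as j)"

definition weak_sequenceable :: "('a, 'b) monoid_scheme \<Rightarrow> nat \<Rightarrow> 'a set \<Rightarrow> bool" where
  "weak_sequenceable G t A \<longleftrightarrow> (\<exists>as. weak_sequencing G t A as)"

definition weak_sequenceable_group :: "('a, 'b) monoid_scheme \<Rightarrow> nat \<Rightarrow> bool" where
  "weak_sequenceable_group G t \<longleftrightarrow>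
     (\<forall>A. A \<subseteq> carrier G - {\<one>\<^bsub>G\<^esub>} \<and> finite A \<and> card A > t \<longrightarrow> weak_sequenceable G t A)"

end

(*
  It suffices to order A so that no block of between 2 and 6 (at most card A - 1) consecutive elements sums
  to 0 modulo p. If A is large, a greedy choice produces such an ordering of all but at most 11 elements.
  The remaining h elements are appended at the two ends. The blocks created in this way are affine-linear
  forms in the new elements, and the combinatorial Nullstellensatz for orderings applies: if P is a product
  of h (h - 1) / 2 affine forms, then its signed sum over all orderings of x_1, ..., x_h is c times the
  Vandermonde determinant, where c depends only on the linear parts of the forms. Hence c can be computed at
  any integer points and with any constant terms, and if p does not divide c, then P does not vanish modulo p
  at some ordering of the remaining elements. The number of blocks leaves room for a further factor, a
  linear form in the elements; it is chosen such that c has no prime factor above 7 (or 5, 3 for small A),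
  which leaves no exceptional p because p > card A.
*)
theory Submission
  imports Defs "HOL-Library.Multiset"
begin

section \<open>Combinatorial Nullstellensatz via signed sums over orderings\<close>

text \<open>The number 11 is forced by degrees: a full window charges five forms for each new
  element, and 5 h = h (h - 1) / 2 exactly for h = 11. With both windows full from the start, all 55
  degrees are then taken by blocks and there is no room for the additional linear form. For smaller
  sets the middle part has fewer than five elements, the windows start short, and the room arises by
  itself; if there is too much of it, factors y - t fill the gap. The additional form is the remedy
  against exceptional primes. The constant c is linear in the coefficients of this form, so a
  combination of two values of c can reach their gcd, and only primes common to both survive. What
  is computed is not c but c times the Vandermonde determinant of the chosen points. These are at
  most 11 consecutive integers, whose differences have no prime factors above 7.\<close>

text \<open>
  \<open>pick f xs\<close> is the sum of \<open>(-1)^i * f x r\<close>, where \<open>x\<close> is the element of \<open>xs\<close> at position \<open>i\<close> and \<open>r\<close> lists the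
  others. Iterating it, \<open>signed_sum n F xs\<close> is the sum of \<open>sign \<pi> * F (\<pi> xs)\<close> over all permutations \<open>\<pi>\<close>.
\<close>

fun pick :: "('a \<Rightarrow> 'a list \<Rightarrow> int) \<Rightarrow> 'a list \<Rightarrow> int" where
  "pick f [] = 0"
| "pick f (x # xs) = f x xs - pick (\<lambda>y r. f y (x # r)) xs"

lemma pick_cong:
  assumes "\<And>y r. mset (y # r) = mset xs \<Longrightarrow> f y r = g y r"
  shows "pick f xs = pick g xs"
  using assms
proof (induction xs arbitrary: f g)
  case (Cons x xs)
  have "pick (\<lambda>y r. f y (x # r)) xs = pick (\<lambda>y r. g y (x # r)) xs"
    by (rule Cons.IH) (simp add: Cons.prems add_mset_commute)
  then show ?case using Cons.prems[of x xs] by simp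
qed simp

lemma pick_add: "pick (\<lambda>y r. f y r + g y r) xs = pick f xs + pick g xs"
  by (induction xs arbitrary: f g) auto

lemma pick_scale: "pick (\<lambda>y r. c * f y r) xs = c * pick f xs"
  by (induction xs arbitrary: f) (auto simp: algebra_simps)

lemma pick_uminus: "pick (\<lambda>y r. - f y r) xs = - pick f xs"
  using pick_scale[of "-1"] by simp

lemma pick_diff: "pick (\<lambda>y r. f y r - g y r) xs = pick f xs - pick g xs"
  using pick_add[of f "\<lambda>y r. - g y r"] by (simp add: pick_uminus)

lemma pick_zero [simp]: "pick (\<lambda>y r. 0) xs = 0"
  using pick_scale[of 0] by simp

text \<open>Exchanging the first two picks composes the permutation with a transposition, whence the
  sign. The antisymmetry of the signed sums of monomials rests on this identity.\<close>

lemma pick_swap: "pick (\<lambda>y r. pick (\<lambda>z r'. g y z r') r) xs = - pick (\<lambda>y r. pick (\<lambda>z r'. g z y r') r) xs"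
proof (induction xs arbitrary: g)
  case (Cons x xs)
  show ?case
    using Cons.IH[of "\<lambda>y z r. g y z (x # r)"] by (simp add: pick_diff)
qed simp

lemma pick_nonzero:
  assumes "\<not> (p :: int) dvd pick f xs"
  shows "\<exists>y r. mset (y # r) = mset xs \<and> \<not> p dvd f y r"
  using assms
proof (induction xs arbitrary: f)
  case (Cons x xs)
  show ?case
  proof (cases "p dvd f x xs")
    case True
    then have "\<not> p dvd pick (\<lambda>y r. f y (x # r)) xs" using Cons.prems by auto
    from Cons.IH[OF this] obtain y r where "mset (y # r) = mset xs" "\<not> p dvd f y (x # r)" by blast
    then show ?thesis by (intro exI[of _ y] exI[of _ "x # r"]) auto
  qed auto
qed simp

primrec signed_sum :: "nat \<Rightarrow> ('a list \<Rightarrow> int) \<Rightarrow> 'a list \<Rightarrow> int" where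
  "signed_sum 0 F xs = F []"
| "signed_sum (Suc n) F xs = pick (\<lambda>y r. signed_sum n (\<lambda>l. F (y # l)) r) xs"

lemma signed_sum_cong:
  assumes "\<And>l. mset l = mset xs \<Longrightarrow> F l = G l" "length xs = n"
  shows "signed_sum n F xs = signed_sum n G xs"
  using assms
proof (induction n arbitrary: F G xs)
  case (Suc n)
  show ?case unfolding signed_sum.simps
  proof (rule pick_cong)
    fix y r assume m: "mset (y # r) = mset xs"
    then have "length r = n" using Suc.prems(2) by (metis length_Cons nat.inject size_mset)
    moreover have "F (y # l) = G (y # l)" if "mset l = mset r" for l
      by (rule Suc.prems(1)) (use m that in auto)
    ultimately show "signed_sum n (\<lambda>l. F (y # l)) r = signed_sum n (\<lambda>l. G (y # l)) r"
      by (intro Suc.IH) auto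
  qed
qed simp

lemma signed_sum_add: "signed_sum n (\<lambda>l. F l + G l) xs = signed_sum n F xs + signed_sum n G xs"
  by (induction n arbitrary: F G xs) (auto simp: pick_add)

lemma signed_sum_scale: "signed_sum n (\<lambda>l. c * F l) xs = c * signed_sum n F xs"
  by (induction n arbitrary: F xs) (auto simp: pick_scale)

lemma signed_sum_zero [simp]: "signed_sum n (\<lambda>l. 0) xs = 0"
  using signed_sum_scale[of n 0] by simp

lemma signed_sum_nonzero:
  assumes "\<not> (p :: int) dvd signed_sum n F xs" "length xs = n"
  shows "\<exists>l. mset l = mset xs \<and> \<not> p dvd F l"
  using assms
proof (induction n arbitrary: F xs)
  case (Suc n)
  from pick_nonzero[OF Suc.prems(1)[unfolded signed_sum.simps]] obtain y r
    where m: "mset (y # r) = mset xs" and nz: "\<not> p dvd signed_sum n (\<lambda>l. F (y # l)) r" by blast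
  have "length r = n" using m Suc.prems(2) by (metis length_Cons nat.inject size_mset)
  from Suc.IH[OF nz this] obtain l where "mset l = mset r" "\<not> p dvd F (y # l)" by blast
  then show ?case using m by (intro exI[of _ "y # l"]) auto
qed auto

text \<open>The identity ordering carries the sign +1, and since the entries are distinct no other
  permutation reproduces \<open>xs\<close>.\<close>

lemma signed_sum_single:
  assumes "length xs = n" "distinct xs" "\<And>l. mset l = mset xs \<Longrightarrow> l \<noteq> xs \<Longrightarrow> F l = 0"
  shows "signed_sum n F xs = F xs"
  using assms
proof (induction n arbitrary: F xs)
  case (Suc n)
  then obtain x xs' where xs: "xs = x # xs'" by (cases xs) auto
  have 1: "signed_sum n (\<lambda>l. F (x # l)) xs' = F (x # xs')"
    by (rule Suc.IH) (use Suc.prems xs in auto)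
  have "pick (\<lambda>y r. signed_sum n (\<lambda>l. F (y # l)) (x # r)) xs' = pick (\<lambda>y r. 0) xs'"
  proof (rule pick_cong)
    fix y r assume m: "mset (y # r) = mset xs'"
    then have "y \<in> set xs'" by (metis list.set_intros(1) set_mset_mset)
    then have yx: "y \<noteq> x" using Suc.prems(2) xs by auto
    have len: "length (x # r) = n"
      using m Suc.prems(1) xs by (metis Suc_inject length_Cons size_mset)
    have "signed_sum n (\<lambda>l. F (y # l)) (x # r) = signed_sum n (\<lambda>l. 0) (x # r)"
    proof (rule signed_sum_cong[OF _ len])
      fix l assume "mset l = mset (x # r)"
      then show "F (y # l) = 0" using m xs yx by (intro Suc.prems(3)) auto
    qed
    then show "signed_sum n (\<lambda>l. F (y # l)) (x # r) = 0" by simp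
  qed
  with 1 show ?case using xs by simp
qed simp

section \<open>Alternating sums of monomials and the Vandermonde determinant\<close>

primrec monomial :: "nat list \<Rightarrow> int list \<Rightarrow> int" where
  "monomial [] l = 1"
| "monomial (e # es) l = hd l ^ e * monomial es (tl l)"

lemma monomial_conv: "length l = length es \<Longrightarrow> monomial es l = (\<Prod>i<length es. l ! i ^ (es ! i))"
proof (induction es arbitrary: l)
  case (Cons e es)
  then obtain x l' where l: "l = x # l'" by (cases l) auto
  then show ?case using Cons by (simp add: prod.lessThan_Suc_shift del: prod.lessThan_Suc)
qed simp

lemma signed_sum_monomial_swap: "signed_sum (Suc (Suc n)) (monomial (a # b # es)) xs = - signed_sum (Suc (Suc n)) (monomial (b # a # es)) xs"
proof -
  have *: "signed_sum (Suc (Suc n)) (monomial (a # b # es)) xs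
      = pick (\<lambda>y r. pick (\<lambda>z r'. (y ^ a * z ^ b) * signed_sum n (monomial es) r') r) xs" for a b
    by (simp add: signed_sum_scale[symmetric] mult.assoc)
  show ?thesis unfolding *
    by (subst pick_swap) (simp add: mult.commute)
qed

lemma signed_sum_monomial_Cons: "signed_sum (Suc n) (monomial (e # es)) xs = pick (\<lambda>y r. y ^ e * signed_sum n (monomial es) r) xs"
  by (simp add: signed_sum_scale)

text \<open>Insertion moves an exponent by adjacent transpositions, each of which flips the sign.
  The sign must not depend on \<open>xs\<close>; its value is irrelevant.\<close>

lemma signed_sum_monomial_insort:
  "\<exists>s. s \<in> {1, - 1} \<and> (\<forall>xs. signed_sum (Suc (length es)) (monomial (e # es)) xs = s * signed_sum (Suc (length es)) (monomial (insort e es)) xs)"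
proof (induction es)
  case Nil
  show ?case by (rule exI[of _ 1]) auto
next
  case (Cons a es)
  show ?case
  proof (cases "e \<le> a")
    case True
    then show ?thesis by (intro exI[of _ 1]) auto
  next
    case False
    obtain s where s: "s \<in> {1, - 1}" "\<And>xs. signed_sum (Suc (length es)) (monomial (e # es)) xs = s * signed_sum (Suc (length es)) (monomial (insort e es)) xs"
      using Cons by blast
    have "signed_sum (Suc (length (a # es))) (monomial (e # a # es)) xs = (- s) * signed_sum (Suc (length (a # es))) (monomial (insort e (a # es))) xs" for xs
    proof -
      have "signed_sum (Suc (Suc (length es))) (monomial (e # a # es)) xs = - signed_sum (Suc (Suc (length es))) (monomial (a # e # es)) xs"
        by (rule signed_sum_monomial_swap)
      also have "signed_sum (Suc (Suc (length es))) (monomial (a # e # es)) xs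
          = pick (\<lambda>y r. y ^ a * signed_sum (Suc (length es)) (monomial (e # es)) r) xs"
        by (rule signed_sum_monomial_Cons)
      also have "\<dots> = pick (\<lambda>y r. s * (y ^ a * signed_sum (Suc (length es)) (monomial (insort e es)) r)) xs"
        by (simp only: s(2)) (simp add: mult.left_commute)
      also have "\<dots> = s * signed_sum (Suc (Suc (length es))) (monomial (a # insort e es)) xs"
        by (simp only: signed_sum_monomial_Cons pick_scale)
      finally show ?thesis using False by simp
    qed
    then show ?thesis using s(1) by (intro exI[of _ "- s"]) auto
  qed
qed

lemma signed_sum_monomial_sort:
  "\<exists>s. s \<in> {1, - 1} \<and> (\<forall>xs. signed_sum (length es) (monomial es) xs = s * signed_sum (length es) (monomial (sort es)) xs)"
proof (induction es)
  case Nil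
  show ?case by (rule exI[of _ 1]) auto
next
  case (Cons e es)
  obtain s where s: "s \<in> {1, - 1}" "\<And>xs. signed_sum (length es) (monomial es) xs = s * signed_sum (length es) (monomial (sort es)) xs"
    using Cons by blast
  obtain t where t: "t \<in> {1, - 1}" "\<And>xs. signed_sum (Suc (length es)) (monomial (e # sort es)) xs = t * signed_sum (Suc (length es)) (monomial (insort e (sort es))) xs"
    using signed_sum_monomial_insort[of "sort es" e] by auto
  have "signed_sum (length (e # es)) (monomial (e # es)) xs = (s * t) * signed_sum (length (e # es)) (monomial (sort (e # es))) xs" for xs
  proof -
    have "signed_sum (length (e # es)) (monomial (e # es)) xs = pick (\<lambda>y r. s * (y ^ e * signed_sum (length es) (monomial (sort es)) r)) xs"
      by (simp only: list.size signed_sum_monomial_Cons s(2) add_0_right add_Suc_right) (simp add: mult.left_commute)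
    also have "\<dots> = s * signed_sum (Suc (length es)) (monomial (e # sort es)) xs"
      by (simp only: signed_sum_monomial_Cons pick_scale)
    finally show ?thesis by (simp add: t(2) del: signed_sum.simps)
  qed
  then show ?case using s(1) t(1) by (intro exI[of _ "s * t"]) auto
qed

text \<open>Sortedness makes equal exponents adjacent. Exchanging them changes the sign but not the
  monomial, so the sum is its own negative.\<close>

lemma signed_sum_monomial_dup:
  assumes "sorted es" "\<not> distinct es"
  shows "signed_sum (length es) (monomial es) xs = 0"
  using assms
proof (induction es arbitrary: xs)
  case (Cons a es)
  show ?case
  proof (cases "a \<in> set es")
    case True
    then obtain b es' where es: "es = b # es'" by (cases es) auto
    then have "a = b" using True Cons.prems(1) by auto
    then show ?thesis using signed_sum_monomial_swap[of "length es'" a a es' xs] es by simp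
  next
    case False
    then have "signed_sum (length es) (monomial es) xs = 0" for xs
      using Cons by auto
    then show ?thesis by (simp only: list.size signed_sum_monomial_Cons add_0_right add_Suc_right) simp
  qed
qed simp

lemma sorted_distinct_ge:
  fixes es :: "nat list"
  assumes "sorted es" "distinct es" "i < length es"
  shows "i \<le> es ! i"
  using assms(3)
proof (induction i)
  case (Suc i)
  have "es ! i < es ! Suc i"
    using assms Suc.prems by (metis Suc_lessD le_eq_less_or_eq lessI n_not_Suc_n nth_eq_iff_index_eq sorted_nth_mono)
  then show ?case using Suc by simp
qed simp

lemma sum_upt: "(\<Sum>i<n. i) = n * (n - 1) div (2::nat)"
  by (metis Sum_Ico_nat atLeast0LessThan diff_zero mult_0 minus_nat.diff_0)

text \<open>Strictly increasing exponents dominate 0, 1, ..., n - 1 termwise, and a single strict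
  inequality already exceeds the bound. This makes n (n - 1) / 2 the least degree at which an
  alternating sum can survive.\<close>

lemma sorted_distinct_sum:
  fixes es :: "nat list"
  assumes "sorted es" "distinct es" "sum_list es \<le> length es * (length es - 1) div 2"
  shows "es = [0..<length es]"
proof -
  let ?n = "length es"
  have s: "sum_list es = (\<Sum>i<?n. es ! i)" by (simp add: sum_list_sum_nth atLeast0LessThan)
  have "es ! i = i" if i: "i < ?n" for i
  proof (rule ccontr)
    assume "es ! i \<noteq> i"
    then have "i < es ! i" using sorted_distinct_ge[OF assms(1,2) i] by simp
    then have "(\<Sum>i<?n. i) < (\<Sum>i<?n. es ! i)"
      using sorted_distinct_ge[OF assms(1,2)] i by (intro sum_strict_mono_ex1) auto
    then show False using assms(3) s by (simp add: sum_upt)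
  qed
  then show ?thesis by (intro nth_equalityI) auto
qed

text \<open>The Leibniz expansion of det (x_i ^ j).\<close>

definition vandermonde :: "int list \<Rightarrow> int" where
  "vandermonde xs = signed_sum (length xs) (monomial [0..<length xs]) xs"

text \<open>In this range of degrees the sorted exponents either repeat, which gives 0, or are
  exactly 0, ..., n - 1.\<close>

lemma signed_sum_monomial_vandermonde:
  assumes "length es = n" "sum_list es \<le> n * (n - 1) div 2"
  shows "\<exists>c. (sum_list es < n * (n - 1) div 2 \<longrightarrow> c = 0) \<and> (\<forall>xs. length xs = n \<longrightarrow> signed_sum n (monomial es) xs = c * vandermonde xs)"
proof -
  obtain s where s: "\<And>xs. signed_sum (length es) (monomial es) xs = s * signed_sum (length es) (monomial (sort es)) xs"
    using signed_sum_monomial_sort by blast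
  have sum: "sum_list (sort es) = sum_list es"
    by (metis mset_sort sum_mset_sum_list)
  show ?thesis
  proof (cases "distinct es")
    case False
    then have "signed_sum (length es) (monomial es) xs = 0" for xs
      using s signed_sum_monomial_dup[of "sort es"] by simp
    then show ?thesis using assms by (intro exI[of _ 0]) auto
  next
    case True
    then have e: "sort es = [0..<n]"
      using sorted_distinct_sum[of "sort es"] assms sum by simp
    have "sum_list es = n * (n - 1) div 2"
      unfolding sum[symmetric] e sum_upt[symmetric] by (simp add: sum_list_distinct_conv_sum_set atLeast0LessThan)
    then show ?thesis using s e assms by (intro exI[of _ s]) (auto simp: vandermonde_def)
  qed
qed

text \<open>
  \<open>is_pol n P F\<close>: on lists of length \<open>n\<close>, \<open>F\<close> is a polynomial all of whose monomials have a total degree satisfying \<open>P\<close>.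
\<close>

definition is_pol :: "nat \<Rightarrow> (nat \<Rightarrow> bool) \<Rightarrow> (int list \<Rightarrow> int) \<Rightarrow> bool" where
  "is_pol n P F \<longleftrightarrow> (\<exists>ts. (\<forall>(c, es) \<in> set ts. length es = n \<and> P (sum_list es)) \<and>
     (\<forall>l. length l = n \<longrightarrow> F l = (\<Sum>(c, es)\<leftarrow>ts. c * monomial es l)))"

lemma polI:
  assumes "\<And>c es. (c, es) \<in> set ts \<Longrightarrow> length es = n \<and> P (sum_list es)"
    and "\<And>l. length l = n \<Longrightarrow> F l = (\<Sum>(c, es)\<leftarrow>ts. c * monomial es l)"
  shows "is_pol n P F"
  unfolding is_pol_def by (rule exI[of _ ts]) (use assms in auto)

lemma is_pol_zero: "is_pol n P (\<lambda>l. 0)"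
  by (rule polI[of "[]"]) auto

lemma is_pol_one: "P 0 \<Longrightarrow> is_pol n P (\<lambda>l. 1)"
  by (rule polI[of "[(1, replicate n 0)]"]) (auto simp: monomial_conv sum_list_replicate)

lemma is_pol_add:
  assumes "is_pol n P F" "is_pol n P G"
  shows "is_pol n P (\<lambda>l. F l + G l)"
proof -
  obtain ts us where ts: "\<forall>(c, es) \<in> set ts. length es = n \<and> P (sum_list es)"
      "\<forall>l. length l = n \<longrightarrow> F l = (\<Sum>(c, es)\<leftarrow>ts. c * monomial es l)"
    and us: "\<forall>(c, es) \<in> set us. length es = n \<and> P (sum_list es)"
      "\<forall>l. length l = n \<longrightarrow> G l = (\<Sum>(c, es)\<leftarrow>us. c * monomial es l)"
    using assms unfolding is_pol_def by blast
  show ?thesis by (rule polI[of "ts @ us"]) (use ts us in auto)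
qed

lemma is_pol_scale:
  assumes "is_pol n P F"
  shows "is_pol n P (\<lambda>l. c * F l)"
proof -
  obtain ts where ts: "\<forall>(c, es) \<in> set ts. length es = n \<and> P (sum_list es)"
      "\<forall>l. length l = n \<longrightarrow> F l = (\<Sum>(c, es)\<leftarrow>ts. c * monomial es l)"
    using assms unfolding is_pol_def by blast
  show ?thesis
    by (rule polI[of "map (\<lambda>(d, es). (c * d, es)) ts"])
       (use ts in \<open>auto simp: o_def case_prod_unfold sum_list_const_mult mult.assoc\<close>)
qed

lemma is_pol_mono: "is_pol n P F \<Longrightarrow> (\<And>s. P s \<Longrightarrow> Q s) \<Longrightarrow> is_pol n Q F"
  unfolding is_pol_def by fast

lemma monomial_update:
  assumes "length l = length es" "i < length es"
  shows "monomial (es[i := Suc (es ! i)]) l = l ! i * monomial es l"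
proof -
  have "(\<Prod>j<length es. l ! j ^ (es[i := Suc (es ! i)] ! j))
      = (\<Prod>j<length es. (if j = i then l ! i else 1) * l ! j ^ (es ! j))"
    using assms by (intro prod.cong) (auto simp: nth_list_update)
  also have "\<dots> = l ! i * (\<Prod>j<length es. l ! j ^ (es ! j))"
    using assms by (simp add: prod.distrib prod.delta)
  finally show ?thesis using assms by (simp add: monomial_conv)
qed

lemma is_pol_var:
  assumes "is_pol n P F" "i < n" "\<And>s. P s \<Longrightarrow> Q (Suc s)"
  shows "is_pol n Q (\<lambda>l. l ! i * F l)"
proof -
  obtain ts where ts: "\<forall>(c, es) \<in> set ts. length es = n \<and> P (sum_list es)"
      "\<forall>l. length l = n \<longrightarrow> F l = (\<Sum>(c, es)\<leftarrow>ts. c * monomial es l)"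
    using assms unfolding is_pol_def by blast
  let ?us = "map (\<lambda>(c, es). (c, es[i := Suc (es ! i)])) ts"
  show ?thesis
  proof (rule polI[of ?us])
    fix c es assume "(c, es) \<in> set ?us"
    then obtain es' where e: "(c, es') \<in> set ts" "es = es'[i := Suc (es' ! i)]" by auto
    then have "length es' = n" "P (sum_list es')" using ts(1) by auto
    then show "length es = n \<and> Q (sum_list es)"
      using e(2) assms(2,3) member_le_sum_list[of "es' ! i" es']
      by (auto simp: sum_list_update)
  next
    fix l :: "int list" assume l: "length l = n"
    have "l ! i * F l = (\<Sum>(c, es)\<leftarrow>ts. l ! i * (c * monomial es l))"
      using ts(2) l by (simp add: sum_list_const_mult case_prod_unfold)
    also have "\<dots> = (\<Sum>(c, es)\<leftarrow>ts. c * monomial (es[i := Suc (es ! i)]) l)"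
      by (rule arg_cong[of _ _ sum_list], rule map_cong) (use ts(1) l assms(2) in \<open>auto simp: monomial_update\<close>)
    finally show "l ! i * F l = (\<Sum>(c, es)\<leftarrow>?us. c * monomial es l)"
      by (simp add: o_def case_prod_unfold)
  qed
qed

section \<open>Products of affine forms and their leading parts\<close>

definition linform :: "nat \<Rightarrow> (nat \<Rightarrow> int) \<Rightarrow> int list \<Rightarrow> int" where
  "linform n a l = (\<Sum>i<n. a i * l ! i)"

lemma is_pol_linform:
  assumes "is_pol n P F" "\<And>s. P s \<Longrightarrow> Q (Suc s)"
  shows "is_pol n Q (\<lambda>l. linform n a l * F l)"
proof -
  have "is_pol n Q (\<lambda>l. (\<Sum>i<m. a i * l ! i) * F l)" if "m \<le> n" for m
    using that
  proof (induction m)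
    case (Suc m)
    have "is_pol n Q (\<lambda>l. (\<Sum>i<m. a i * l ! i) * F l + a m * (l ! m * F l))"
      using Suc assms by (intro is_pol_add is_pol_scale is_pol_var[of n P F]) auto
    then show ?case by (simp add: algebra_simps)
  qed (simp add: is_pol_zero)
  then show ?thesis unfolding linform_def by blast
qed

definition prodform :: "nat \<Rightarrow> ((nat \<Rightarrow> int) \<times> int) list \<Rightarrow> int list \<Rightarrow> int" where
  "prodform n fs l = (\<Prod>(a, w)\<leftarrow>fs. linform n a l + w)"

definition topform :: "nat \<Rightarrow> (nat \<Rightarrow> int) list \<Rightarrow> int list \<Rightarrow> int" where
  "topform n as l = (\<Prod>a\<leftarrow>as. linform n a l)"

lemma is_pol_topform: "is_pol n (\<lambda>s. s = length as) (topform n as)"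
proof (induction as)
  case (Cons a as)
  show ?case
    using is_pol_linform[OF Cons, of "\<lambda>s. s = length (a # as)" a] by (simp add: topform_def)
qed (simp add: topform_def is_pol_one)

text \<open>If T is the leading part of the shorter product and R the rest, then (a + w) (T + R) - a
  T = a R + w R + w T, where each summand has lower degree than a T.\<close>

lemma is_pol_prodform: "is_pol n (\<lambda>s. s < length fs) (\<lambda>l. prodform n fs l - topform n (map fst fs) l)"
proof (induction fs)
  case (Cons f fs)
  obtain a w where f: "f = (a, w)" by force
  let ?R = "\<lambda>l. prodform n fs l - topform n (map fst fs) l"
  have 1: "is_pol n (\<lambda>s. s < length (f # fs)) (\<lambda>l. linform n a l * ?R l)"
    by (rule is_pol_linform[OF Cons]) auto
  have 2: "is_pol n (\<lambda>s. s < length (f # fs)) (\<lambda>l. w * ?R l)"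
    by (rule is_pol_scale, rule is_pol_mono[OF Cons]) auto
  have 3: "is_pol n (\<lambda>s. s < length (f # fs)) (\<lambda>l. w * topform n (map fst fs) l)"
    by (rule is_pol_scale, rule is_pol_mono[OF is_pol_topform]) auto
  show ?case
    using is_pol_add[OF is_pol_add[OF 1 2] 3] by (simp add: f prodform_def topform_def algebra_simps)
qed (simp add: prodform_def topform_def is_pol_zero)

lemma signed_sum_sum_list: "signed_sum n (\<lambda>l. \<Sum>(c, es)\<leftarrow>ts. c * monomial es l) xs = (\<Sum>(c, es)\<leftarrow>ts. c * signed_sum n (monomial es) xs)"
  by (induction ts) (auto simp: signed_sum_add signed_sum_scale case_prod_unfold)

lemma signed_sum_is_pol_low:
  assumes "is_pol n (\<lambda>s. s < n * (n - 1) div 2) F" "length xs = n"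
  shows "signed_sum n F xs = 0"
proof -
  obtain ts where ts: "\<forall>(c, es) \<in> set ts. length es = n \<and> sum_list es < n * (n - 1) div 2"
      "\<forall>l. length l = n \<longrightarrow> F l = (\<Sum>(c, es)\<leftarrow>ts. c * monomial es l)"
    using assms unfolding is_pol_def by blast
  have "signed_sum n F xs = signed_sum n (\<lambda>l. \<Sum>(c, es)\<leftarrow>ts. c * monomial es l) xs"
    using ts(2) assms(2) by (intro signed_sum_cong) (auto dest: mset_eq_length)
  also have "\<dots> = (\<Sum>(c, es)\<leftarrow>ts. 0)"
    unfolding signed_sum_sum_list
  proof (rule arg_cong[of _ _ sum_list], rule map_cong, safe)
    fix c es assume "(c, es) \<in> set ts"
    then have "length es = n" "sum_list es < n * (n - 1) div 2" using ts(1) by auto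
    then show "c * signed_sum n (monomial es) xs = 0"
      using signed_sum_monomial_vandermonde[of es n] assms(2) by auto
  qed
  finally show ?thesis by (simp add: case_prod_unfold sum_list_triv)
qed

lemma signed_sum_is_pol_top:
  assumes "is_pol n (\<lambda>s. s = n * (n - 1) div 2) F"
  shows "\<exists>c. \<forall>xs. length xs = n \<longrightarrow> signed_sum n F xs = c * vandermonde xs"
proof -
  obtain ts where ts: "\<forall>(c, es) \<in> set ts. length es = n \<and> sum_list es = n * (n - 1) div 2"
      "\<forall>l. length l = n \<longrightarrow> F l = (\<Sum>(c, es)\<leftarrow>ts. c * monomial es l)"
    using assms unfolding is_pol_def by blast
  have "\<exists>c. \<forall>xs. length xs = n \<longrightarrow> (\<Sum>(c, es)\<leftarrow>ts. c * signed_sum n (monomial es) xs) = c * vandermonde xs"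
    using ts(1)
  proof (induction ts)
    case (Cons t ts)
    obtain b es where t: "t = (b, es)" by force
    obtain c where c: "\<And>xs. length xs = n \<Longrightarrow> (\<Sum>(c, es)\<leftarrow>ts. c * signed_sum n (monomial es) xs) = c * vandermonde xs"
      using Cons by auto
    have "length es = n" "sum_list es \<le> n * (n - 1) div 2" using Cons.prems t by auto
    then obtain d where d: "\<And>xs. length xs = n \<Longrightarrow> signed_sum n (monomial es) xs = d * vandermonde xs"
      using signed_sum_monomial_vandermonde by blast
    show ?case
      by (rule exI[of _ "b * d + c"]) (simp add: t c d algebra_simps)
  qed auto
  then obtain c where c: "\<And>xs. length xs = n \<Longrightarrow> (\<Sum>(c, es)\<leftarrow>ts. c * signed_sum n (monomial es) xs) = c * vandermonde xs"
    by blast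
  have "signed_sum n F xs = c * vandermonde xs" if "length xs = n" for xs
  proof -
    have "signed_sum n F xs = signed_sum n (\<lambda>l. \<Sum>(c, es)\<leftarrow>ts. c * monomial es l) xs"
      using ts(2) that by (intro signed_sum_cong) (auto dest: mset_eq_length)
    then show ?thesis using c[OF that] by (simp add: signed_sum_sum_list)
  qed
  then show ?thesis by blast
qed

text \<open>Constant terms only influence monomials of degree below n (n - 1) / 2, and alternation
  annihilates these.\<close>

lemma signed_sum_prodform:
  assumes "length fs = n * (n - 1) div 2" "length xs = n"
  shows "signed_sum n (prodform n fs) xs = signed_sum n (topform n (map fst fs)) xs"
proof -
  let ?R = "\<lambda>l. prodform n fs l - topform n (map fst fs) l"
  have "signed_sum n (prodform n fs) xs = signed_sum n (\<lambda>l. topform n (map fst fs) l + ?R l) xs"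
    by simp
  also have "\<dots> = signed_sum n (topform n (map fst fs)) xs + signed_sum n ?R xs"
    by (rule signed_sum_add)
  also have "signed_sum n ?R xs = 0"
    using signed_sum_is_pol_low[OF _ assms(2)] is_pol_prodform[of n fs] assms(1) by simp
  finally show ?thesis by simp
qed

lemma topform_mset:
  assumes "mset as = mset bs"
  shows "topform n as = topform n bs"
  unfolding topform_def by (rule ext) (metis assms mset_map prod_mset_prod_list)

text \<open>The product formula follows from the irrelevance of constant terms. The product of all
  l_i - x_j with j < i has the leading part of the Vandermonde monomial, so both have the same
  signed sum; but the product vanishes at every ordering other than \<open>xs\<close>, where it is
  the product of the differences.\<close>

lemma vandermonde_not_dvd:
  fixes p :: int
  assumes "prime p" and dist: "\<And>i j. i < length xs \<Longrightarrow> j < i \<Longrightarrow> \<not> p dvd xs ! i - xs ! j"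
  shows "\<not> p dvd vandermonde xs"
proof -
  define n where "n = length xs"
  define fs where "fs = concat (map (\<lambda>i. map (\<lambda>j. ((\<lambda>k. if k = i then 1 else 0 :: int), - (xs ! j))) [0..<i]) [0..<n])"
  have linform: "linform n (\<lambda>k. if k = i then 1 else 0) l = l ! i" if "i < n" for i l
    using that by (simp add: linform_def sum.delta if_distrib[of "\<lambda>x. x * _"] cong: if_cong)
  have len: "length fs = n * (n - 1) div 2"
    using sum_upt[of n] by (simp add: fs_def length_concat o_def sum_list_distinct_conv_sum_set atLeast0LessThan)
  have pf: "prodform n fs l = (\<Prod>i<n. \<Prod>j<i. l ! i - xs ! j)" for l
  proof -
    have "prodform n fs l = prod_list (map (\<lambda>i. prod_list (map (\<lambda>j. l ! i - xs ! j) [0..<i])) [0..<n])"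
    proof -
      have "prodform n (concat (map (\<lambda>i. map (\<lambda>j. ((\<lambda>k. if k = i then 1 else 0 :: int), - (xs ! j))) [0..<i]) is)) l
        = prod_list (map (\<lambda>i. prod_list (map (\<lambda>j. l ! i - xs ! j) [0..<i])) is)" if "set is \<subseteq> {..<n}" for "is"
        using that by (induction "is") (simp_all add: prodform_def o_def linform)
      then show ?thesis by (simp add: fs_def subset_iff)
    qed
    then show ?thesis by (simp add: prod.distinct_set_conv_list[symmetric] atLeast0LessThan)
  qed
  have top: "topform n (map fst fs) l = monomial [0..<n] l" if "length l = n" for l
  proof -
    have "topform n (map fst fs) l = prod_list (map (\<lambda>i. prod_list (map (\<lambda>j. l ! i) [0..<i])) [0..<n])"
    proof -
      have "topform n (map fst (concat (map (\<lambda>i. map (\<lambda>j. ((\<lambda>k. if k = i then 1 else 0 :: int), - (xs ! j))) [0..<i]) is))) l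
        = prod_list (map (\<lambda>i. prod_list (map (\<lambda>j. l ! i) [0..<i])) is)" if "set is \<subseteq> {..<n}" for "is"
        using that by (induction "is") (simp_all add: topform_def o_def linform)
      then show ?thesis by (simp add: fs_def subset_iff)
    qed
    also have "\<dots> = (\<Prod>i<n. l ! i ^ i)"
      by (simp add: prod.distinct_set_conv_list[symmetric] atLeast0LessThan map_replicate_const)
    finally show ?thesis using that by (simp add: monomial_conv)
  qed
  have "vandermonde xs = signed_sum n (topform n (map fst fs)) xs"
    unfolding vandermonde_def n_def[symmetric]
    by (rule signed_sum_cong) (use top n_def in \<open>auto dest: mset_eq_length\<close>)
  also have "\<dots> = signed_sum n (prodform n fs) xs"
    by (rule signed_sum_prodform[symmetric]) (use len n_def in auto)
  also have "\<dots> = prodform n fs xs"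
  proof (rule signed_sum_single)
    show "distinct xs"
      unfolding distinct_conv_nth
    proof (intro allI impI)
      fix i j assume "i < length xs" "j < length xs" "i \<noteq> j"
      then show "xs ! i \<noteq> xs ! j"
        using dist[of i j] dist[of j i] by (cases "i < j") auto
    qed
    fix l assume l: "mset l = mset xs" "l \<noteq> xs"
    have ll: "length l = n" using l(1) n_def mset_eq_length by blast
    show "prodform n fs l = 0"
    proof (rule ccontr)
      assume "prodform n fs l \<noteq> 0"
      then have ne: "l ! i \<noteq> xs ! j" if "i < n" "j < i" for i j
        using that unfolding pf by (auto simp: prod_zero_iff)
      \<comment> \<open>From the last position downwards: l_i differs from x_j for j < i because no
        factor vanishes, and for j > i because x_j already stands at position j.\<close>
      have "l ! i = xs ! i" if "i < n" for i
        using that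
      proof (induction "n - i" arbitrary: i rule: less_induct)
        case less
        have "l ! i \<in> set xs" using l(1) less.prems ll by (metis mset_eq_setD nth_mem)
        then obtain j where j: "j < n" "l ! i = xs ! j" by (auto simp: in_set_conv_nth n_def)
        have "\<not> j < i" using ne[of i j] j less.prems by auto
        moreover have "\<not> i < j"
        proof
          assume "i < j"
          then have "l ! j = xs ! j" using less.hyps[of j] j(1) by auto
          then have "l ! j = l ! i" using j by simp
          moreover have "distinct l" using l(1) \<open>distinct xs\<close> by (metis mset_eq_imp_distinct_iff)
          ultimately show False using \<open>i < j\<close> j(1) ll by (auto simp: nth_eq_iff_index_eq)
        qed
        ultimately show ?case using j by (metis linorder_neqE_nat)
      qed
      then have "l = xs" using ll n_def by (intro nth_equalityI) auto
      then show False using l(2) by simp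
    qed
  qed (simp add: n_def)
  finally have v: "vandermonde xs = (\<Prod>i<n. \<Prod>j<i. xs ! i - xs ! j)" by (simp add: pf)
  show ?thesis unfolding v
    using assms(1) dist n_def by (auto simp: prime_dvd_prod_iff)
qed

theorem combinatorial_nullstellensatz:
  fixes p :: int
  assumes "prime p"
    and len: "length fs = n * (n - 1) div 2" and tops: "mset (map fst fs') = mset (map fst fs)"
    and A: "length A = n" "\<not> p dvd signed_sum n (prodform n fs) A"
    and xs: "length xs = n" "\<And>i j. i < length xs \<Longrightarrow> j < i \<Longrightarrow> \<not> p dvd xs ! i - xs ! j"
  obtains l where "mset l = mset xs" "\<not> p dvd prodform n fs' l"
proof -
  have len': "length fs' = n * (n - 1) div 2"
    using len tops by (metis length_map size_mset)
  obtain c where c: "\<And>xs. length xs = n \<Longrightarrow> signed_sum n (topform n (map fst fs)) xs = c * vandermonde xs"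
    using signed_sum_is_pol_top[of n "topform n (map fst fs)"] is_pol_topform[of n "map fst fs"] len by auto
  \<comment> \<open>The integers in \<open>A\<close> are a mere probe: since p does not divide c
    times the Vandermonde determinant of \<open>A\<close>, it does not divide c.\<close>
  have "\<not> p dvd c" using A c[OF A(1)] signed_sum_prodform[OF len A(1)] by auto
  moreover have "signed_sum n (prodform n fs') xs = c * vandermonde xs"
    using signed_sum_prodform[OF len' xs(1)] topform_mset[OF tops] c[OF xs(1)] by simp
  moreover have "\<not> p dvd vandermonde xs" using vandermonde_not_dvd[OF assms(1) xs(2)] .
  ultimately have "\<not> p dvd signed_sum n (prodform n fs') xs"
    using assms(1) by (simp add: prime_dvd_mult_iff)
  from signed_sum_nonzero[OF this xs(1)] show ?thesis using that by blast
qed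

section \<open>Extending an ordering at both ends\<close>

text \<open>A block reaches back from its last element to at most \<open>w\<close> others, whence
  \<open>Suc w\<close>. Single elements are exempt, so a placeholder 0 may occur in a block-free
  list.\<close>

definition block_free :: "nat \<Rightarrow> int \<Rightarrow> int list \<Rightarrow> bool" where
  "block_free w p s \<longleftrightarrow> (\<forall>us bs vs. s = us @ bs @ vs \<longrightarrow> 2 \<le> length bs \<longrightarrow> length bs \<le> Suc w \<longrightarrow> \<not> p dvd sum_list bs)"

lemma block_free_rev [simp]: "block_free w p (rev s) = block_free w p s"
proof -
  have "block_free w p (rev s)" if "block_free w p s" for s
    unfolding block_free_def
  proof (intro allI impI)
    fix us bs vs assume *: "rev s = us @ bs @ vs" "2 \<le> length bs" "length bs \<le> Suc w"
    then have "s = rev vs @ rev bs @ rev us" by (metis append_assoc rev_append rev_rev_ident)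
    then have "\<not> p dvd sum_list (rev bs)"
      using that *(2,3) unfolding block_free_def by (metis length_rev)
    then show "\<not> p dvd sum_list bs" by (simp add: sum_list_rev)
  qed
  from this[of s] this[of "rev s"] show ?thesis by auto
qed

definition window :: "nat \<Rightarrow> int list \<Rightarrow> int list" where
  "window w s = map (\<lambda>i. sum_list (take i s)) [1..<Suc (min w (length s))]"

lemma length_window [simp]: "length (window w s) = min w (length s)"
  by (simp add: window_def del: upt_Suc)

lemma block_free_Cons:
  assumes "block_free w p s" "\<And>u. u \<in> set (window w s) \<Longrightarrow> \<not> p dvd y + u"
  shows "block_free w p (y # s)"
  unfolding block_free_def
proof (intro allI impI)
  fix us bs vs assume *: "y # s = us @ bs @ vs" "2 \<le> length bs" "length bs \<le> Suc w"
  show "\<not> p dvd sum_list bs"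
  proof (cases us)
    case Nil
    then obtain bs' where bs: "bs = y # bs'" "s = bs' @ vs" using * by (cases bs) auto
    have "sum_list bs' \<in> set (window w s)"
      unfolding window_def set_map
      by (rule image_eqI[of _ _ "length bs'"]) (use bs * in auto)
    then show ?thesis using assms(2) bs by auto
  next
    case (Cons u us')
    then show ?thesis using assms(1) * unfolding block_free_def by auto
  qed
qed

lemma window_Cons: "window w (y # s) = take w (y # map ((+) y) (window w s))"
proof (rule nth_equalityI)
  fix i assume "i < length (window w (y # s))"
  then have i: "i < w" "i \<le> length s" by auto
  show "window w (y # s) ! i = take w (y # map ((+) y) (window w s)) ! i"
    using i by (cases i) (auto simp: window_def nth_append min_def simp del: upt_Suc)
qed auto

text \<open>An element added at the far end is seen by the window only while the list is shorter
  than \<open>w\<close>; the new entry is then the sum of the whole list, and 0 stands for the sum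
  of the empty one.\<close>

definition ext_window :: "nat \<Rightarrow> int list \<Rightarrow> int \<Rightarrow> int list" where
  "ext_window w rs y = (if length rs < w then rs @ [(if rs = [] then 0 else last rs) + y] else rs)"

lemma window_snoc: "window w (s @ [y]) = ext_window w (window w s) y"
proof (cases "length s < w")
  case True
  have "(if window w s = [] then 0 else last (window w s)) = sum_list s"
  proof (cases s)
    case (Cons a list)
    have "window w s \<noteq> []" using Cons True by (auto simp flip: length_greater_0_conv)
    then have "last (window w s) = window w s ! (length s - 1)" using True by (simp add: last_conv_nth)
    also have "\<dots> = sum_list s"
      using True Cons by (simp add: window_def nth_append del: upt_Suc)
    finally show ?thesis using \<open>window w s \<noteq> []\<close> by simp
  qed (simp add: window_def)
  moreover have "window w (s @ [y]) = window w s @ [sum_list s + y]"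
    using True by (auto simp: window_def)
  ultimately show ?thesis using True by (simp add: ext_window_def)
next
  case False
  then show ?thesis by (simp add: ext_window_def window_def)
qed

datatype side = Lt | Rt

primrec build :: "side list \<Rightarrow> 'a list \<Rightarrow> 'a list \<Rightarrow> 'a list" where
  "build [] mid l = mid"
| "build (m # ms) mid l = build ms (case m of Lt \<Rightarrow> hd l # mid | Rt \<Rightarrow> mid @ [hd l]) (tl l)"

text \<open>
  The windows \<open>ls\<close> and \<open>rs\<close> hold the sums of the up to \<open>w\<close> outermost elements at the left and at the right end;
  the factors of \<open>walk\<close> are therefore the sums of the blocks that end in a newly placed element.
\<close>

primrec walk :: "nat \<Rightarrow> side list \<Rightarrow> int list \<Rightarrow> int list \<Rightarrow> int list \<Rightarrow> int" where
  "walk w [] ls rs l = 1"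
| "walk w (m # ms) ls rs l = (case m of
      Lt \<Rightarrow> (\<Prod>u\<leftarrow>ls. hd l + u) * walk w ms (take w (hd l # map ((+) (hd l)) ls)) (ext_window w rs (hd l)) (tl l)
    | Rt \<Rightarrow> (\<Prod>u\<leftarrow>rs. hd l + u) * walk w ms (ext_window w ls (hd l)) (take w (hd l # map ((+) (hd l)) rs)) (tl l))"

lemma prod_list_not_dvd:
  fixes p :: int
  shows "\<not> p dvd (\<Prod>x\<leftarrow>xs. f x) \<Longrightarrow> x \<in> set xs \<Longrightarrow> \<not> p dvd f x"
  by (induction xs) (auto intro: dvd_mult dvd_mult2)

lemma mset_build: "length l = length ms \<Longrightarrow> mset (build ms mid l) = mset mid + mset l"
proof (induction ms arbitrary: mid l)
  case (Cons m ms)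
  then obtain y l' where "l = y # l'" by (cases l) auto
  then show ?case using Cons by (cases m) auto
qed simp

lemma walk_block_free:
  assumes "block_free w p mid" "\<not> p dvd walk w ms (window w mid) (window w (rev mid)) l" "length l = length ms"
  shows "block_free w p (build ms mid l)"
  using assms
proof (induction ms arbitrary: mid l)
  case (Cons m ms)
  then obtain y l' where l: "l = y # l'" by (cases l) auto
  show ?case
  proof (cases m)
    case Lt
    have "window w (rev (y # mid)) = ext_window w (window w (rev mid)) y" by (simp add: window_snoc)
    then have *: "\<not> p dvd (\<Prod>u\<leftarrow>window w mid. y + u) * walk w ms (window w (y # mid)) (window w (rev (y # mid))) l'"
      using Cons.prems(2) by (simp add: Lt l window_Cons)
    have "block_free w p (y # mid)"
    proof (rule block_free_Cons[OF Cons.prems(1)])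
      fix u assume "u \<in> set (window w mid)"
      moreover have "\<not> p dvd (\<Prod>u\<leftarrow>window w mid. y + u)" using * by auto
      ultimately show "\<not> p dvd y + u" by (rule prod_list_not_dvd[rotated])
    qed
    moreover have "\<not> p dvd walk w ms (window w (y # mid)) (window w (rev (y # mid))) l'" using * by auto
    ultimately show ?thesis using Cons.IH[of "y # mid" l'] Cons.prems(3) by (simp add: l Lt)
  next
    case Rt
    have r: "rev (mid @ [y]) = y # rev mid" by simp
    have *: "\<not> p dvd (\<Prod>u\<leftarrow>window w (rev mid). y + u) * walk w ms (window w (mid @ [y])) (window w (rev (mid @ [y]))) l'"
      using Cons.prems(2) by (simp add: Rt l window_Cons window_snoc)
    have "block_free w p (y # rev mid)"
    proof (rule block_free_Cons)
      show "block_free w p (rev mid)" using Cons.prems(1) by simp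
      fix u assume "u \<in> set (window w (rev mid))"
      moreover have "\<not> p dvd (\<Prod>u\<leftarrow>window w (rev mid). y + u)" using * by auto
      ultimately show "\<not> p dvd y + u" by (rule prod_list_not_dvd[rotated])
    qed
    then have "block_free w p (mid @ [y])" by (metis block_free_rev r)
    moreover have "\<not> p dvd walk w ms (window w (mid @ [y])) (window w (rev (mid @ [y]))) l'" using * by auto
    ultimately show ?thesis using Cons.IH[of "mid @ [y]" l'] Cons.prems(3) by (simp add: l Rt)
  qed
qed simp

text \<open>
  An item \<open>(s, c)\<close> is the affine form \<open>(\<Sum>i\<leftarrow>s. l ! i) + c\<close> in the placed elements \<open>l\<close>. Only the supports \<open>s\<close> matter for
  the Nullstellensatz, so the constants of the actual windows may be replaced by arbitrary ones.
\<close>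

type_synonym item = "nat list \<times> int"

definition addv :: "nat \<Rightarrow> item \<Rightarrow> item" where "addv j x = (j # fst x, snd x)"

definition item_val :: "int list \<Rightarrow> item \<Rightarrow> int" where "item_val l x = (\<Sum>i\<leftarrow>fst x. l ! i) + snd x"

definition fext :: "nat \<Rightarrow> item list \<Rightarrow> nat \<Rightarrow> item list" where
  "fext w rs j = (if length rs < w then rs @ [addv j (if rs = [] then ([], 0) else last rs)] else rs)"

primrec factors :: "nat \<Rightarrow> side list \<Rightarrow> nat \<Rightarrow> item list \<Rightarrow> item list \<Rightarrow> item list" where
  "factors w [] j ls rs = []"
| "factors w (m # ms) j ls rs = (case m of
      Lt \<Rightarrow> map (addv j) ls @ factors w ms (Suc j) (take w (([j], 0) # map (addv j) ls)) (fext w rs j)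
    | Rt \<Rightarrow> map (addv j) rs @ factors w ms (Suc j) (fext w ls j) (take w (([j], 0) # map (addv j) rs)))"

lemma item_val_addv: "item_val l (addv j x) = l ! j + item_val l x"
  by (simp add: item_val_def addv_def)

lemma map_item_val_fext: "map (item_val l) (fext w rs j) = ext_window w (map (item_val l) rs) (l ! j)"
  by (auto simp: fext_def ext_window_def item_val_addv last_map) (simp add: item_val_def)

lemma map_item_val_take:
  "map (item_val l) (take w (([j], 0) # map (addv j) ls)) = take w (l ! j # map ((+) (l ! j)) (map (item_val l) ls))"
  by (simp add: take_map[symmetric] item_val_addv o_def) (simp add: item_val_def)

lemma map_item_val_take':
  "take w (l ! j # map (\<lambda>x. l ! j + item_val l x) ls) = map (item_val l) (take w (([j], 0) # map (addv j) ls))"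
  by (simp add: map_item_val_take o_def)

lemma walk_factors:
  assumes "j + length ms \<le> length l"
  shows "walk w ms (map (item_val l) ls) (map (item_val l) rs) (drop j l) = (\<Prod>x\<leftarrow>factors w ms j ls rs. item_val l x)"
  using assms
proof (induction ms arbitrary: j ls rs)
  case (Cons m ms)
  have d: "hd (drop j l) = l ! j" "tl (drop j l) = drop (Suc j) l"
    using Cons.prems by (auto simp: hd_drop_conv_nth tl_drop drop_Suc)
  show ?case
    using Cons.IH[of "Suc j"] Cons.prems
    by (cases m) (simp_all add: d o_def item_val_addv map_item_val_take' flip: map_item_val_fext)
qed simp

definition sext :: "nat \<Rightarrow> nat list list \<Rightarrow> nat \<Rightarrow> nat list list" where
  "sext w rs j = (if length rs < w then rs @ [j # (if rs = [] then [] else last rs)] else rs)"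

text \<open>The linear parts of the factors depend only on the moves and on the lengths of the
  initial windows, not on their entries.\<close>

primrec supports :: "nat \<Rightarrow> side list \<Rightarrow> nat \<Rightarrow> nat list list \<Rightarrow> nat list list \<Rightarrow> nat list list" where
  "supports w [] j ls rs = []"
| "supports w (m # ms) j ls rs = (case m of
      Lt \<Rightarrow> map ((#) j) ls @ supports w ms (Suc j) (take w ([j] # map ((#) j) ls)) (sext w rs j)
    | Rt \<Rightarrow> map ((#) j) rs @ supports w ms (Suc j) (sext w ls j) (take w ([j] # map ((#) j) rs)))"

lemma map_fst_factors: "map fst (factors w ms j ls rs) = supports w ms j (map fst ls) (map fst rs)"
proof (induction ms arbitrary: j ls rs)
  case (Cons m ms)
  have 1: "map fst (fext w rs j) = sext w (map fst rs) j" for rs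
    by (auto simp: fext_def sext_def addv_def last_map)
  have 2: "map fst (take w (([j], 0) # map (addv j) ls)) = take w ([j] # map ((#) j) (map fst ls))" for ls
    by (simp add: take_map[symmetric] addv_def o_def)
  have 3: "map (fst \<circ> addv j) ls = map ((#) j \<circ> fst) ls" for ls
    by (simp add: addv_def o_def)
  show ?case by (cases m) (simp_all only: factors.simps supports.simps side.case map_append Cons 1 2 map_map 3)
qed simp

lemma sext_less:
  assumes "\<And>s i. s \<in> set rs \<Longrightarrow> i \<in> set s \<Longrightarrow> i < j" "s \<in> set (sext w rs j)" "i \<in> set s"
  shows "i < Suc j"
proof -
  have "s \<in> set rs \<or> s = [j] \<or> (rs \<noteq> [] \<and> s = j # last rs)"
    using assms(2) by (auto simp: sext_def split: if_splits)
  then show ?thesis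
  proof (elim disjE conjE)
    assume "s \<in> set rs"
    then show ?thesis using assms(1,3) less_SucI by blast
  next
    assume "rs \<noteq> []" "s = j # last rs"
    then show ?thesis using assms(1)[OF last_in_set] assms(3) by (auto simp: less_Suc_eq)
  qed (use assms(3) in auto)
qed

lemma take_less:
  assumes "\<And>s i. s \<in> set ls \<Longrightarrow> i \<in> set s \<Longrightarrow> i < j" "s \<in> set (take w ([j] # map ((#) j) ls))" "i \<in> set s"
  shows "i < Suc j"
proof -
  have "s \<in> set ([j] # map ((#) j) ls)" using assms(2) by (rule in_set_takeD)
  then consider "s = [j]" | s' where "s' \<in> set ls" "s = j # s'" by auto
  then show ?thesis using assms(1,3) by cases (auto simp: less_Suc_eq)
qed

lemma supports_less:
  assumes "s \<in> set (supports w ms j ls rs)" "\<And>s i. s \<in> set ls \<Longrightarrow> i \<in> set s \<Longrightarrow> i < j"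
    "\<And>s i. s \<in> set rs \<Longrightarrow> i \<in> set s \<Longrightarrow> i < j" "i \<in> set s"
  shows "i < j + length ms"
  using assms
proof (induction ms arbitrary: j ls rs)
  case (Cons m ms)
  have here: "i < j + length (m # ms)" if s: "s \<in> (#) j ` set xs" and less: "\<And>s i. s \<in> set xs \<Longrightarrow> i \<in> set s \<Longrightarrow> i < j" for xs
  proof -
    obtain s' where "s' \<in> set xs" "s = j # s'" using s by auto
    then have "i \<le> j" using less[of s' i] Cons.prems(4) by auto
    then show ?thesis by simp
  qed
  show ?case
  proof (cases m)
    case Lt
    consider "s \<in> (#) j ` set ls" | "s \<in> set (supports w ms (Suc j) (take w ([j] # map ((#) j) ls)) (sext w rs j))"
      using Cons.prems(1) Lt by auto
    then show ?thesis
    proof cases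
      case 1
      then show ?thesis using here Cons.prems(2) by blast
    next
      case 2
      have "i < Suc j + length ms"
        by (rule Cons.IH[OF 2 _ _ Cons.prems(4)])
           (erule (1) take_less[rotated] sext_less[rotated], erule (1) Cons.prems)+
      then show ?thesis by simp
    qed
  next
    case Rt
    consider "s \<in> (#) j ` set rs" | "s \<in> set (supports w ms (Suc j) (sext w ls j) (take w ([j] # map ((#) j) rs)))"
      using Cons.prems(1) Rt by auto
    then show ?thesis
    proof cases
      case 1
      then show ?thesis using here Cons.prems(3) by blast
    next
      case 2
      have "i < Suc j + length ms"
        by (rule Cons.IH[OF 2 _ _ Cons.prems(4)])
           (erule (1) take_less[rotated] sext_less[rotated], erule (1) Cons.prems)+
      then show ?thesis by simp
    qed
  qed
qed simp

section \<open>From lists of indices to linear forms\<close>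

definition cf :: "nat list \<Rightarrow> nat \<Rightarrow> int" where "cf s i = int (count_list s i)"

lemma linform_cf: "set s \<subseteq> {..<n} \<Longrightarrow> linform n (cf s) l = (\<Sum>i\<leftarrow>s. l ! i)"
proof (induction s)
  case (Cons a s)
  have "linform n (cf (a # s)) l = (\<Sum>i<n. (if i = a then l ! i else 0) + cf s i * l ! i)"
    unfolding linform_def by (rule sum.cong) (auto simp: cf_def algebra_simps)
  also have "\<dots> = l ! a + linform n (cf s) l"
    using Cons.prems by (simp add: sum.distrib linform_def)
  finally show ?case using Cons by simp
qed (simp add: linform_def cf_def)

definition itemform :: "item \<Rightarrow> (nat \<Rightarrow> int) \<times> int" where
  "itemform x = (cf (fst x), snd x)"

lemma prodform_items:
  assumes "\<And>x. x \<in> set fs \<Longrightarrow> set (fst x) \<subseteq> {..<n}"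
  shows "prodform n (map itemform fs) l = (\<Prod>x\<leftarrow>fs. item_val l x)"
  using assms by (induction fs) (simp_all add: prodform_def itemform_def item_val_def linform_cf)

lemma prodform_append: "prodform n (xs @ ys) l = prodform n xs l * prodform n ys l"
  by (simp add: prodform_def)

text \<open>Two families of constants meet here: \<open>lu\<close> and \<open>ru\<close> are chosen
  for the computation at \<open>A\<close>, while \<open>fs\<close> carries those of the actual list;
  only the supports have to agree. The forms \<open>es\<close> fill up the degree.\<close>

lemma walk_nullstellensatz:
  fixes p :: int
  assumes p: "prime p" and n: "n = length ms"
    and sz: "length es + length (supports w ms 0 (replicate (length lu) []) (replicate (length ru) [])) = n * (n - 1) div 2"
    and A: "length A = n" "\<not> p dvd signed_sum n (\<lambda>l. prodform n es l * walk w ms lu ru l) A"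
    and fs: "mset (map fst fs) = mset (supports w ms 0 (replicate (length lu) []) (replicate (length ru) []))"
    and xs: "length xs = n" "\<And>i j. i < length xs \<Longrightarrow> j < i \<Longrightarrow> \<not> p dvd xs ! i - xs ! j"
  obtains l where "mset l = mset xs" "\<And>x. x \<in> set fs \<Longrightarrow> \<not> p dvd item_val l x"
proof -
  let ?S = "supports w ms 0 (replicate (length lu) []) (replicate (length ru) [])"
  let ?fv = "factors w ms 0 (map (Pair []) lu) (map (Pair []) ru)"
  have fv: "map fst ?fv = ?S"
    by (simp add: map_fst_factors o_def map_replicate_const)
  have S: "set s \<subseteq> {..<n}" if "s \<in> set ?S" for s
  proof
    fix i assume "i \<in> set s"
    have "i < 0 + length ms"
      by (rule supports_less[OF that _ _ \<open>i \<in> set s\<close>]) (auto split: if_splits)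
    then show "i \<in> {..<n}" using n by simp
  qed
  have in_S: "fst x \<in> set ?S" if "x \<in> set ?fv" for x
    using that unfolding fv[symmetric] by auto
  have in_S': "fst x \<in> set ?S" if "x \<in> set fs" for x
    using that fs by (metis image_eqI mset_eq_setD set_map)
  have "signed_sum n (prodform n (es @ map itemform ?fv)) A = signed_sum n (\<lambda>l. prodform n es l * walk w ms lu ru l) A"
  proof (rule signed_sum_cong[OF _ A(1)])
    fix l assume "mset l = mset A"
    then have "length l = n" using A(1) mset_eq_length by blast
    then have "walk w ms (map (item_val l) (map (Pair []) lu)) (map (item_val l) (map (Pair []) ru)) (drop 0 l) = (\<Prod>x\<leftarrow>?fv. item_val l x)"
      by (intro walk_factors) (simp add: n)
    then show "prodform n (es @ map itemform ?fv) l = prodform n es l * walk w ms lu ru l"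
      using prodform_items[of ?fv n l] in_S S by (auto simp: prodform_append o_def item_val_def)
  qed
  then have A': "\<not> p dvd signed_sum n (prodform n (es @ map itemform ?fv)) A" using A(2) by simp
  have "map fst (map itemform fs') = map cf (map fst fs')" for fs'
    by (simp add: itemform_def o_def)
  then have tops: "mset (map fst (es @ map itemform fs)) = mset (map fst (es @ map itemform ?fv))"
    using fs fv by (metis map_append mset_append mset_map)
  have len: "length (es @ map itemform ?fv) = n * (n - 1) div 2"
    using sz fv by (metis length_append length_map)
  from combinatorial_nullstellensatz[OF p len tops A(1) A' xs]
  obtain l where l: "mset l = mset xs" "\<not> p dvd prodform n (es @ map itemform fs) l" by blast
  then have "\<not> p dvd (\<Prod>x\<leftarrow>fs. item_val l x)"
    using prodform_items[of fs n l] in_S' S by (auto simp: prodform_append)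
  then show ?thesis
    by (intro that[OF l(1)]) (rule prod_list_not_dvd)
qed


section \<open>Signed sums of walks\<close>

primrec chain_prod :: "nat \<Rightarrow> int list \<Rightarrow> int list \<Rightarrow> int" where
  "chain_prod w us [] = 1"
| "chain_prod w us (y # l) = (\<Prod>u\<leftarrow>us. y + u) * chain_prod w (take w (y # map ((+) y) us)) l"

definition chain :: "nat \<Rightarrow> int list \<Rightarrow> int list \<Rightarrow> int" where
  "chain w us xs = signed_sum (length xs) (chain_prod w us) xs"

lemma chain_Nil: "chain w us [] = 1"
  by (simp add: chain_def)

lemma chain_pick:
  assumes "xs \<noteq> []"
  shows "chain w us xs = pick (\<lambda>y r. (\<Prod>u\<leftarrow>us. y + u) * chain w (take w (y # map ((+) y) us)) r) xs"
proof -
  obtain n where n: "length xs = Suc n" using assms by (cases xs) auto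
  have "chain w us xs = pick (\<lambda>y r. (\<Prod>u\<leftarrow>us. y + u) * signed_sum n (chain_prod w (take w (y # map ((+) y) us))) r) xs"
    using n by (simp add: chain_def signed_sum_scale)
  also have "\<dots> = pick (\<lambda>y r. (\<Prod>u\<leftarrow>us. y + u) * chain w (take w (y # map ((+) y) us)) r) xs"
  proof (rule pick_cong)
    fix y r assume "mset (y # r) = mset xs"
    then have "length r = n" using n by (metis length_Cons nat.inject size_mset)
    then show "(\<Prod>u\<leftarrow>us. y + u) * signed_sum n (chain_prod w (take w (y # map ((+) y) us))) r =
        (\<Prod>u\<leftarrow>us. y + u) * chain w (take w (y # map ((+) y) us)) r"
      by (simp add: chain_def)
  qed
  finally show ?thesis .
qed

text \<open>Laplace expansion: the signed sum over all ways to split \<open>xs\<close> into \<open>a\<close> elements and the rest.\<close>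

fun split_sum :: "nat \<Rightarrow> ('a list \<Rightarrow> 'a list \<Rightarrow> int) \<Rightarrow> 'a list \<Rightarrow> int" where
  "split_sum 0 K xs = K [] xs"
| "split_sum (Suc a) K [] = 0"
| "split_sum (Suc a) K (x # xs) = split_sum a (\<lambda>ys zs. K (x # ys) zs) xs + (- 1) ^ Suc a * split_sum (Suc a) (\<lambda>ys zs. K ys (x # zs)) xs"

lemma split_sum_add: "split_sum a (\<lambda>ys zs. K ys zs + K' ys zs) xs = split_sum a K xs + split_sum a K' xs"
proof (induction xs arbitrary: a K K')
  case Nil
  show ?case by (cases a) auto
next
  case (Cons x xs)
  show ?case
  proof (cases a)
    case (Suc b)
    show ?thesis
      using Cons[of b "\<lambda>ys zs. K (x # ys) zs" "\<lambda>ys zs. K' (x # ys) zs"]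
        Cons[of a "\<lambda>ys zs. K ys (x # zs)" "\<lambda>ys zs. K' ys (x # zs)"]
      by (simp add: Suc algebra_simps)
  qed simp
qed

lemma split_sum_scale: "split_sum a (\<lambda>ys zs. c * K ys zs) xs = c * split_sum a K xs"
  by (induction a K xs rule: split_sum.induct) (simp_all add: algebra_simps)

lemma split_sum_diff: "split_sum a (\<lambda>ys zs. K ys zs - K' ys zs) xs = split_sum a K xs - split_sum a K' xs"
  using split_sum_add[of a K "\<lambda>ys zs. (- 1) * K' ys zs" xs] split_sum_scale[of a "- 1" K' xs] by simp

lemma split_sum_cong:
  assumes "\<And>ys zs. mset ys + mset zs = mset xs \<Longrightarrow> length ys = a \<Longrightarrow> K ys zs = K' ys zs"
  shows "split_sum a K xs = split_sum a K' xs"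
  using assms
proof (induction a K xs arbitrary: K' rule: split_sum.induct)
  case (3 a K x xs)
  have "split_sum a (\<lambda>ys zs. K (x # ys) zs) xs = split_sum a (\<lambda>ys zs. K' (x # ys) zs) xs"
    by (rule 3(1)) (simp add: 3(3))
  moreover have "split_sum (Suc a) (\<lambda>ys zs. K ys (x # zs)) xs = split_sum (Suc a) (\<lambda>ys zs. K' ys (x # zs)) xs"
    by (rule 3(2)) (simp add: 3(3))
  ultimately show ?case by simp
qed auto

text \<open>On both sides the sign counts the pairs in which an unchosen element precedes a chosen
  one, plus the chosen elements that precede the first pick.\<close>

lemma split_sum_pick: "pick (\<lambda>y r. split_sum a (\<lambda>ys zs. K y ys zs) r) xs = split_sum (Suc a) (\<lambda>ys' zs. pick (\<lambda>y ys. K y ys zs) ys') xs"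
proof (induction xs arbitrary: a K)
  case (Cons x xs)
  show ?case
  proof (cases a)
    case 0
    show ?thesis
      using Cons.IH[of 0 "\<lambda>y ys zs. K y ys (x # zs)"] by (simp add: 0)
  next
    case (Suc b)
    show ?thesis
      using Cons.IH[of b "\<lambda>y ys zs. K y (x # ys) zs"] Cons.IH[of a "\<lambda>y ys zs. K y ys (x # zs)"]
      by (simp add: Suc pick_add pick_diff pick_scale split_sum_diff)
  qed
qed simp

lemma pick_scale_right: "pick (\<lambda>y r. f y r * c) xs = pick f xs * c"
  using pick_scale[of c f xs] by (simp add: mult.commute)

text \<open>For a product of this kind the orderings of the two parts are independent, so a sum over
  (a + b)! orderings becomes one over subsets with sums over a! and b! orderings.\<close>

lemma signed_sum_split:
  assumes "length xs = a + b"
  shows "signed_sum (a + b) (\<lambda>l. F (take a l) * G (drop a l)) xs = split_sum a (\<lambda>ys zs. signed_sum a F ys * signed_sum b G zs) xs"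
  using assms
proof (induction a arbitrary: F xs)
  case 0
  show ?case by (simp add: signed_sum_scale)
next
  case (Suc a)
  have "signed_sum (Suc a + b) (\<lambda>l. F (take (Suc a) l) * G (drop (Suc a) l)) xs
      = pick (\<lambda>y r. signed_sum (a + b) (\<lambda>l. F (y # take a l) * G (drop a l)) r) xs"
    by simp
  also have "\<dots> = pick (\<lambda>y r. split_sum a (\<lambda>ys zs. signed_sum a (\<lambda>l. F (y # l)) ys * signed_sum b G zs) r) xs"
  proof (rule pick_cong)
    fix y r assume "mset (y # r) = mset xs"
    then have "length r = a + b" using Suc.prems by (metis add_Suc length_Cons nat.inject size_mset)
    from Suc.IH[OF this, of "\<lambda>l. F (y # l)"]
    show "signed_sum (a + b) (\<lambda>l. F (y # take a l) * G (drop a l)) r = split_sum a (\<lambda>ys zs. signed_sum a (\<lambda>l. F (y # l)) ys * signed_sum b G zs) r" .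
  qed
  also have "\<dots> = split_sum (Suc a) (\<lambda>ys' zs. pick (\<lambda>y ys. signed_sum a (\<lambda>l. F (y # l)) ys * signed_sum b G zs) ys') xs"
    by (rule split_sum_pick)
  also have "\<dots> = split_sum (Suc a) (\<lambda>ys zs. signed_sum (Suc a) F ys * signed_sum b G zs) xs"
    by (simp add: pick_scale_right)
  finally show ?case .
qed

lemma walk_right: "length l = b \<Longrightarrow> walk w (replicate b Rt) ls rs l = chain_prod w rs l"
proof (induction b arbitrary: l ls rs)
  case (Suc b)
  then obtain y l' where "l = y # l'" by (cases l) auto
  then show ?case using Suc by simp
qed simp

lemma length_ext_window: "length (ext_window w rs y) = (if length rs < w then Suc (length rs) else length rs)"
  by (simp add: ext_window_def)

text \<open>A full right window is not changed by left moves, so the two sides no longer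
  interact.\<close>

lemma walk_left_right:
  "length l = a + b \<Longrightarrow> w \<le> length ls + a \<Longrightarrow> w \<le> length rs \<Longrightarrow>
    walk w (replicate a Lt @ replicate b Rt) ls rs l = chain_prod w ls (take a l) * chain_prod w rs (drop a l)"
proof (induction a arbitrary: l ls)
  case 0
  then show ?case by (simp add: walk_right)
next
  case (Suc a)
  then obtain y l' where "l = y # l'" by (cases l) auto
  moreover have "ext_window w rs y = rs" using Suc.prems by (simp add: ext_window_def)
  ultimately show ?case using Suc by (simp add: mult_ac)
qed

text \<open>The \<open>a\<close> left elements share the coefficient \<gamma> and the right ones
  have coefficient 0. The linear form thus depends on the splitting only, not on the order within
  the parts, and comes out of the inner sums.\<close>

definition walk_sum_split :: "nat \<Rightarrow> nat \<Rightarrow> int \<Rightarrow> int \<Rightarrow> int list \<Rightarrow> int list \<Rightarrow> int list \<Rightarrow> int" where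
  "walk_sum_split w a \<gamma> s ls rs xs = split_sum a (\<lambda>ys zs. (s + \<gamma> * sum_list ys) * (chain w ls ys * chain w rs zs)) xs"

text \<open>
  Besides the walk, the summand contains the factors \<open>y - t\<close> for the first element \<open>y\<close> and \<open>t\<close> in \<open>ks\<close>, and the linear form
  with coefficients \<open>qs\<close> at the first elements and \<open>\<gamma>\<close> at the following \<open>a\<close> left moves; \<open>s\<close> accumulates its value.
\<close>

primrec walk_sum :: "nat \<Rightarrow> side list \<Rightarrow> int list \<Rightarrow> nat \<Rightarrow> int \<Rightarrow> int list \<Rightarrow> int \<Rightarrow> int list \<Rightarrow> int list \<Rightarrow> int list \<Rightarrow> int" where
  "walk_sum w [] ks a \<gamma> qs s ls rs xs = walk_sum_split w a \<gamma> s ls rs xs"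
| "walk_sum w (m # ms) ks a \<gamma> qs s ls rs xs = pick (\<lambda>y r. (\<Prod>t\<leftarrow>ks. y - t) * (case m of
      Lt \<Rightarrow> (\<Prod>u\<leftarrow>ls. y + u) * walk_sum w ms [] a \<gamma> (tl qs) (s + hd qs * y) (take w (y # map ((+) y) ls)) (ext_window w rs y) r
    | Rt \<Rightarrow> (\<Prod>u\<leftarrow>rs. y + u) * walk_sum w ms [] a \<gamma> (tl qs) (s + hd qs * y) (ext_window w ls y) (take w (y # map ((+) y) rs)) r)) xs"

primrec weight :: "int list \<Rightarrow> int \<Rightarrow> int \<Rightarrow> nat \<Rightarrow> int list \<Rightarrow> int" where
  "weight [] s \<gamma> a l = s + \<gamma> * sum_list (take a l)"
| "weight (q # qs) s \<gamma> a l = weight qs (s + q * hd l) \<gamma> a (tl l)"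

definition weight_coeff :: "int list \<Rightarrow> int \<Rightarrow> nat \<Rightarrow> nat \<Rightarrow> int" where
  "weight_coeff qs \<gamma> a i = (if i < length qs then qs ! i else if i < length qs + a then \<gamma> else 0)"

lemma weight_linform: "length qs + a \<le> length l \<Longrightarrow> weight qs s \<gamma> a l = s + linform (length l) (weight_coeff qs \<gamma> a) l"
proof (induction qs arbitrary: s l)
  case Nil
  have "sum_list (take a l) = (\<Sum>i<a. l ! i)"
    using Nil by (simp add: sum_list_sum_nth min_def atLeast0LessThan)
  moreover have "linform (length l) (weight_coeff [] \<gamma> a) l = (\<Sum>i<a. \<gamma> * l ! i)"
    unfolding linform_def weight_coeff_def using Nil by (intro sum.mono_neutral_cong_right) auto
  ultimately show ?case by (simp add: sum_distrib_left)
next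
  case (Cons q qs)
  then obtain x l' where l: "l = x # l'" by (cases l) auto
  have "linform (Suc n) c (x # l') = c 0 * x + linform n (\<lambda>i. c (Suc i)) l'" for n c
    unfolding linform_def by (subst sum.lessThan_Suc_shift) simp
  moreover have "(\<lambda>i. weight_coeff (q # qs) \<gamma> a (Suc i)) = weight_coeff qs \<gamma> a" "weight_coeff (q # qs) \<gamma> a 0 = q"
    by (auto simp: weight_coeff_def)
  ultimately show ?case using Cons by (simp add: l)
qed

lemma signed_sum_walk_sum_split:
  assumes "length xs = a + b" "a = 0 \<or> w \<le> length ls + a \<and> w \<le> length rs"
  shows "signed_sum (a + b) (\<lambda>l. (s + \<gamma> * sum_list (take a l)) * walk w (replicate a Lt @ replicate b Rt) ls rs l) xs
    = walk_sum_split w a \<gamma> s ls rs xs"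
proof -
  have "signed_sum (a + b) (\<lambda>l. (s + \<gamma> * sum_list (take a l)) * walk w (replicate a Lt @ replicate b Rt) ls rs l) xs
    = signed_sum (a + b) (\<lambda>l. (\<lambda>l. (s + \<gamma> * sum_list l) * chain_prod w ls l) (take a l) * chain_prod w rs (drop a l)) xs"
  proof (rule signed_sum_cong[OF _ assms(1)])
    fix l assume "mset l = mset xs"
    then have l: "length l = a + b" using assms(1) mset_eq_length by metis
    have "walk w (replicate a Lt @ replicate b Rt) ls rs l = chain_prod w ls (take a l) * chain_prod w rs (drop a l)"
    proof (cases "a = 0")
      case True
      then show ?thesis using walk_right[of l b] l by simp
    next
      case False
      then show ?thesis using assms(2) l walk_left_right[of l a b] by blast
    qed
    then show "(s + \<gamma> * sum_list (take a l)) * walk w (replicate a Lt @ replicate b Rt) ls rs l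
      = (\<lambda>l. (s + \<gamma> * sum_list l) * chain_prod w ls l) (take a l) * chain_prod w rs (drop a l)"
      by simp
  qed
  also have "\<dots> = split_sum a (\<lambda>ys zs. signed_sum a (\<lambda>l. (s + \<gamma> * sum_list l) * chain_prod w ls l) ys * signed_sum b (chain_prod w rs) zs) xs"
    by (rule signed_sum_split[OF assms(1)])
  also have "\<dots> = walk_sum_split w a \<gamma> s ls rs xs"
    unfolding walk_sum_split_def
  proof (rule split_sum_cong)
    fix ys zs assume m: "mset ys + mset zs = mset xs" "length ys = a"
    then have b: "length zs = b"
      using assms(1) by (metis add_left_cancel mset_append size_mset length_append)
    have "signed_sum a (\<lambda>l. (s + \<gamma> * sum_list l) * chain_prod w ls l) ys = signed_sum a (\<lambda>l. (s + \<gamma> * sum_list ys) * chain_prod w ls l) ys"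
    proof (rule signed_sum_cong[OF _ m(2)])
      fix l assume "mset l = mset ys"
      then have "sum_list l = sum_list ys" by (metis sum_mset_sum_list)
      then show "(s + \<gamma> * sum_list l) * chain_prod w ls l = (s + \<gamma> * sum_list ys) * chain_prod w ls l" by simp
    qed
    then show "signed_sum a (\<lambda>l. (s + \<gamma> * sum_list l) * chain_prod w ls l) ys * signed_sum b (chain_prod w rs) zs
      = (s + \<gamma> * sum_list ys) * (chain w ls ys * chain w rs zs)"
      using m(2) b by (simp only: signed_sum_scale chain_def mult.assoc)
  qed
  finally show ?thesis .
qed

text \<open>Every move lengthens both windows until they are full. By the last assumption the right
  one is full after \<open>core\<close> if left moves follow, so the remaining moves split into two
  one-sided walks.\<close>

lemma signed_sum_walk_sum:
  assumes "length xs = length core + a + b" "core = [] \<Longrightarrow> ks = []" "length qs = length core"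
    "a = 0 \<or> w \<le> length ls + length core + a \<and> w \<le> length rs + length core"
  shows "signed_sum (length core + a + b) (\<lambda>l. ((\<Prod>t\<leftarrow>ks. l ! 0 - t) * weight qs s \<gamma> a l) *
      walk w (core @ replicate a Lt @ replicate b Rt) ls rs l) xs
    = walk_sum w core ks a \<gamma> qs s ls rs xs"
  using assms
proof (induction core arbitrary: ks ls rs xs qs s)
  case Nil
  then show ?case using signed_sum_walk_sum_split[of xs a b w ls rs s \<gamma>] by simp
next
  case (Cons m ms)
  obtain q qs' where qs: "qs = q # qs'" "length qs' = length ms" using Cons.prems(3) by (cases qs) auto
  let ?n = "length ms + a + b"
  let ?ms = "ms @ replicate a Lt @ replicate b Rt"
  have len: "length r = ?n" if "mset (y # r) = mset xs" for y :: int and r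
    using that Cons.prems(1) by (metis add_Suc length_Cons nat.inject size_mset)
  have "signed_sum (length (m # ms) + a + b) (\<lambda>l. ((\<Prod>t\<leftarrow>ks. l ! 0 - t) * weight qs s \<gamma> a l) *
      walk w ((m # ms) @ replicate a Lt @ replicate b Rt) ls rs l) xs
    = pick (\<lambda>y r. signed_sum ?n (\<lambda>l. ((\<Prod>t\<leftarrow>ks. y - t) * weight qs' (s + q * y) \<gamma> a l) * walk w (m # ?ms) ls rs (y # l)) r) xs"
    by (simp add: qs)
  also have "\<dots> = walk_sum w (m # ms) ks a \<gamma> qs s ls rs xs"
    unfolding walk_sum.simps
  proof (rule pick_cong)
    fix y r assume m: "mset (y # r) = mset xs"
    \<comment> \<open>The factors from \<open>ks\<close> involve the first element only, hence the
      empty list for the later moves.\<close>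
    note IH = Cons.IH[OF len[OF m], of "[]" qs' _ _ "s + q * y", simplified list.map prod_list.Nil mult_1_left]
    show "signed_sum ?n (\<lambda>l. ((\<Prod>t\<leftarrow>ks. y - t) * weight qs' (s + q * y) \<gamma> a l) * walk w (m # ?ms) ls rs (y # l)) r
      = (\<Prod>t\<leftarrow>ks. y - t) * (case m of
      Lt \<Rightarrow> (\<Prod>u\<leftarrow>ls. y + u) * walk_sum w ms [] a \<gamma> (tl qs) (s + hd qs * y) (take w (y # map ((+) y) ls)) (ext_window w rs y) r
    | Rt \<Rightarrow> (\<Prod>u\<leftarrow>rs. y + u) * walk_sum w ms [] a \<gamma> (tl qs) (s + hd qs * y) (ext_window w ls y) (take w (y # map ((+) y) rs)) r)"
    proof (cases m)
      case Lt
      have c: "a = 0 \<or> w \<le> length (take w (y # map ((+) y) ls)) + length ms + a \<and> w \<le> length (ext_window w rs y) + length ms"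
        using Cons.prems(4) by (auto simp: length_ext_window)
      have "signed_sum ?n (\<lambda>l. ((\<Prod>t\<leftarrow>ks. y - t) * weight qs' (s + q * y) \<gamma> a l) * walk w (m # ?ms) ls rs (y # l)) r
        = signed_sum ?n (\<lambda>l. ((\<Prod>t\<leftarrow>ks. y - t) * (\<Prod>u\<leftarrow>ls. y + u)) * (weight qs' (s + q * y) \<gamma> a l *
            walk w ?ms (take w (y # map ((+) y) ls)) (ext_window w rs y) l)) r"
        by (simp add: Lt mult_ac)
      also have "\<dots> = ((\<Prod>t\<leftarrow>ks. y - t) * (\<Prod>u\<leftarrow>ls. y + u)) *
          walk_sum w ms [] a \<gamma> qs' (s + q * y) (take w (y # map ((+) y) ls)) (ext_window w rs y) r"
        unfolding signed_sum_scale by (subst IH) (use c qs in auto)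
      finally show ?thesis by (simp add: Lt mult_ac qs)
    next
      case Rt
      have c: "a = 0 \<or> w \<le> length (ext_window w ls y) + length ms + a \<and> w \<le> length (take w (y # map ((+) y) rs)) + length ms"
        using Cons.prems(4) by (auto simp: length_ext_window)
      have "signed_sum ?n (\<lambda>l. ((\<Prod>t\<leftarrow>ks. y - t) * weight qs' (s + q * y) \<gamma> a l) * walk w (m # ?ms) ls rs (y # l)) r
        = signed_sum ?n (\<lambda>l. ((\<Prod>t\<leftarrow>ks. y - t) * (\<Prod>u\<leftarrow>rs. y + u)) * (weight qs' (s + q * y) \<gamma> a l *
            walk w ?ms (ext_window w ls y) (take w (y # map ((+) y) rs)) l)) r"
        by (simp add: Rt mult_ac)
      also have "\<dots> = ((\<Prod>t\<leftarrow>ks. y - t) * (\<Prod>u\<leftarrow>rs. y + u)) *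
          walk_sum w ms [] a \<gamma> qs' (s + q * y) (ext_window w ls y) (take w (y # map ((+) y) rs)) r"
        unfolding signed_sum_scale by (subst IH) (use c qs in auto)
      finally show ?thesis by (simp add: Rt mult_ac qs)
    qed
  qed
  finally show ?case .
qed

section \<open>Evaluation by rewriting\<close>

text \<open>
  The equations of this section let the simplifier evaluate \<open>walk_sum\<close> call by value, provided that the congruence
  rule \<open>if_weak_cong\<close> is used: a vanishing factor is detected (by \<open>chk\<close> or an \<open>if\<close>) before the signed sum over
  the remaining elements is expanded. The entries of a full window are separate arguments because list operations
  dominate the running time otherwise; for the same reason the arithmetic rules are monomorphic and, for addition
  and subtraction, proceed by two bits at a time.
\<close>

datatype vl = Z | V int

definition chk :: "int \<Rightarrow> vl" where "chk x = (if x = 0 then Z else V x)"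

primrec rap :: "int list \<Rightarrow> int list \<Rightarrow> int list" where
  "rap [] ys = ys" | "rap (x # xs) ys = rap xs (x # ys)"

lemma rap: "rap xs ys = rev xs @ ys"
  by (induction xs arbitrary: ys) auto

text \<open>Loop state: \<open>pre\<close> holds the elements already tried, in reverse, and
  \<open>post\<close> those still to be tried; \<open>rap\<close> restores the original order of the
  others.\<close>

lemma pick_loop: "pick (\<lambda>y r. f y (rev pre @ r)) (y # post) = f y (rap pre post) - pick (\<lambda>z r. f z (rev (y # pre) @ r)) post"
  by (simp add: rap)

text \<open>
  If all remaining elements \<open>xs\<close> fit into the window, the last element placed completes the blocks consisting of all of
  \<open>xs\<close> and some elements before them. These factors do not depend on the order of \<open>xs\<close> and are split off by
  \<open>reduced_chain\<close>; the sum \<open>s\<close> of \<open>xs\<close> is carried along.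
\<close>

primrec reduced_chain :: "nat \<Rightarrow> int \<Rightarrow> int \<Rightarrow> int \<Rightarrow> int \<Rightarrow> int \<Rightarrow> int \<Rightarrow> int list \<Rightarrow> int" where
  "reduced_chain 0 a b c d e s xs = pick (\<lambda>y r. (y + a) * ((y + b) * ((y + c) * ((y + d) * (y + e))))) xs"
| "reduced_chain (Suc n) a b c d e s xs = pick (\<lambda>y r. (s - y) * ((y + a) * ((y + b) * ((y + c) * ((y + d) * ((y + e) *
     reduced_chain n y (y + a) (y + b) (y + c) (y + d) (s - y) r)))))) xs"

text \<open>A block has at most six elements, so one that contains all n + 2 remaining ones extends
  over 0 to 4 - n earlier elements. These are the 5 - n factors in front.\<close>

lemma chain_reduced_chain:
  assumes "length xs = n + 2" "n \<le> 4"
  shows "chain 5 [a, b, c, d, e] xs = (\<Prod>u\<leftarrow>take (5 - n) [0, a, b, c, d]. sum_list xs + u) * reduced_chain n a b c d e (sum_list xs) xs"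
  using assms
proof (induction n arbitrary: a b c d e xs)
  case 0
  let ?T = "\<lambda>s. s * ((s + a) * ((s + b) * ((s + c) * (s + d))))"
  have "chain 5 [a, b, c, d, e] xs = pick (\<lambda>y r. (\<Prod>u\<leftarrow>[a, b, c, d, e]. y + u) * chain 5 [y, y + a, y + b, y + c, y + d] r) xs"
    using 0 by (subst chain_pick) (auto simp: eval_nat_numeral)
  also have "\<dots> = pick (\<lambda>y r. ?T (sum_list xs) * ((y + a) * ((y + b) * ((y + c) * ((y + d) * (y + e)))))) xs"
  proof (rule pick_cong)
    fix y r assume m: "mset (y # r) = mset xs"
    then have "length r = 1" using 0 mset_eq_length[OF m] by simp
    then obtain z where r: "r = [z]" by (auto simp: length_Suc_conv)
    have s: "sum_list xs = y + z" using arg_cong[OF m, of sum_mset] r by (simp add: sum_mset_sum_list)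
    have z: "z + (y + u) = y + z + u" "z + y = y + z" for u by simp_all
    have "chain 5 [y, y + a, y + b, y + c, y + d] [z] = (\<Prod>u\<leftarrow>[y, y + a, y + b, y + c, y + d]. z + u)"
      by (simp add: chain_def)
    also have "\<dots> = ?T (y + z)"
      by (simp only: list.map prod_list.Cons prod_list.Nil mult_1_right z)
    finally have "chain 5 [y, y + a, y + b, y + c, y + d] [z] = ?T (y + z)" .
    then show "(\<Prod>u\<leftarrow>[a, b, c, d, e]. y + u) * chain 5 [y, y + a, y + b, y + c, y + d] r =
        ?T (sum_list xs) * ((y + a) * ((y + b) * ((y + c) * ((y + d) * (y + e)))))"
      by (simp only: r s list.map prod_list.Cons prod_list.Nil mult_1_right) (rule mult.commute)
  qed
  also have "\<dots> = ?T (sum_list xs) * reduced_chain 0 a b c d e (sum_list xs) xs"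
    by (simp only: pick_scale reduced_chain.simps)
  also have "?T (sum_list xs) = (\<Prod>u\<leftarrow>take (5 - 0) [0, a, b, c, d]. sum_list xs + u)"
    by (simp add: numeral_eq_Suc)
  finally show ?case .
next
  case (Suc n)
  let ?P = "\<lambda>y. (y + a) * ((y + b) * ((y + c) * ((y + d) * (y + e))))"
  let ?T = "\<lambda>s. \<Prod>u\<leftarrow>take (4 - n) [0, a, b, c, d]. s + u"
  have "chain 5 [a, b, c, d, e] xs = pick (\<lambda>y r. ?P y * chain 5 [y, y + a, y + b, y + c, y + d] r) xs"
    using Suc.prems by (subst chain_pick) (auto simp: eval_nat_numeral)
  also have "\<dots> = pick (\<lambda>y r. ?T (sum_list xs) * ((sum_list xs - y) * (?P y * reduced_chain n y (y + a) (y + b) (y + c) (y + d) (sum_list xs - y) r))) xs"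
  proof (rule pick_cong)
    fix y r assume m: "mset (y # r) = mset xs"
    have "length r = n + 2" using Suc.prems(1) mset_eq_length[OF m] by simp
    moreover have s: "sum_list r = sum_list xs - y" using arg_cong[OF m, of sum_mset] by (simp add: sum_mset_sum_list)
    ultimately have 1: "chain 5 [y, y + a, y + b, y + c, y + d] r =
        (\<Prod>u\<leftarrow>take (5 - n) [0, y, y + a, y + b, y + c]. sum_list xs - y + u) * reduced_chain n y (y + a) (y + b) (y + c) (y + d) (sum_list xs - y) r"
      using Suc.IH[of r y "y + a" "y + b" "y + c" "y + d"] Suc.prems(2) by simp
    \<comment> \<open>The entry 0 gives the block of everything after y. The other blocks contain y
      as well, so they contain all of \<open>xs\<close> and join the common factor.\<close>
    have "(\<Prod>u\<leftarrow>take (5 - n) [0, y, y + a, y + b, y + c]. sum_list xs - y + u) = (sum_list xs - y) * ?T (sum_list xs)"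
    proof -
      have "n \<in> {0, 1, 2, 3}" using Suc.prems(2) by auto
      moreover have "s - y + (y + u) = s + u" for s u :: int by simp
      ultimately show ?thesis by (auto simp: eval_nat_numeral)
    qed
    then show "?P y * chain 5 [y, y + a, y + b, y + c, y + d] r =
      ?T (sum_list xs) * ((sum_list xs - y) * (?P y * reduced_chain n y (y + a) (y + b) (y + c) (y + d) (sum_list xs - y) r))"
      unfolding 1 by (simp only: mult.assoc mult.commute mult.left_commute)
  qed
  also have "\<dots> = ?T (sum_list xs) * reduced_chain (Suc n) a b c d e (sum_list xs) xs"
    by (simp add: pick_scale mult.assoc)
  finally show ?case by simp
qed

text \<open>The five factors are tested for zero one after another; the digit counts those not yet
  known to be nonzero, beginning with the argument \<open>t\<close>.\<close>

definition pr5 :: "int \<Rightarrow> int \<Rightarrow> int \<Rightarrow> int \<Rightarrow> int \<Rightarrow> vl \<Rightarrow> int" where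
  "pr5 y b c d e t = (case t of Z \<Rightarrow> 0 | V v \<Rightarrow> v * ((y + b) * ((y + c) * ((y + d) * (y + e)))))"
definition pr4 :: "int \<Rightarrow> int \<Rightarrow> int \<Rightarrow> int \<Rightarrow> int \<Rightarrow> vl \<Rightarrow> int" where
  "pr4 y p c d e t = (case t of Z \<Rightarrow> 0 | V v \<Rightarrow> p * (v * ((y + c) * ((y + d) * (y + e)))))"
definition pr3 :: "int \<Rightarrow> int \<Rightarrow> int \<Rightarrow> int \<Rightarrow> int \<Rightarrow> vl \<Rightarrow> int" where
  "pr3 y p q d e t = (case t of Z \<Rightarrow> 0 | V v \<Rightarrow> p * (q * (v * ((y + d) * (y + e)))))"

definition lp :: "nat \<Rightarrow> int \<Rightarrow> int \<Rightarrow> int \<Rightarrow> int \<Rightarrow> int \<Rightarrow> int \<Rightarrow> int list \<Rightarrow> int list \<Rightarrow> int" where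
  "lp n a b c d e s pre post = pick (\<lambda>y r. (\<lambda>y r. (s - y) * ((y + a) * ((y + b) * ((y + c) * ((y + d) * ((y + e) *
     reduced_chain n y (y + a) (y + b) (y + c) (y + d) (s - y) r)))))) y (rev pre @ r)) post"

lemma lp_Cons: "lp n a b c d e s pre (y # post) =
    (s - y) * ((y + a) * ((y + b) * ((y + c) * ((y + d) * ((y + e) * reduced_chain n y (y + a) (y + b) (y + c) (y + d) (s - y) (rap pre post))))))
    - lp n a b c d e s (y # pre) post"
  unfolding lp_def by (subst pick_loop) (rule refl)

text \<open>The last letter of \<open>lps\<close>, \<open>lpa\<close>, ..., \<open>lpe\<close> names
  the factor being tested. The values found on the way, \<open>p\<close>, \<open>q\<close>,
  \<open>r\<close>, \<open>v\<close>, are at once the entries of the next window.\<close>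

definition lpe :: "nat \<Rightarrow> int \<Rightarrow> int \<Rightarrow> int \<Rightarrow> int \<Rightarrow> int \<Rightarrow> int \<Rightarrow> int list \<Rightarrow> int \<Rightarrow> int list \<Rightarrow> int \<Rightarrow> int \<Rightarrow> int \<Rightarrow> int \<Rightarrow> int \<Rightarrow> vl \<Rightarrow> int" where
  "lpe n a b c d e s pre y post s' p q r v t = (case t of Z \<Rightarrow> 0
     | V x \<Rightarrow> s' * (p * (q * (r * (v * (x * reduced_chain n y p q r v s' (rap pre post))))))) - lp n a b c d e s (y # pre) post"
definition lpd :: "nat \<Rightarrow> int \<Rightarrow> int \<Rightarrow> int \<Rightarrow> int \<Rightarrow> int \<Rightarrow> int \<Rightarrow> int list \<Rightarrow> int \<Rightarrow> int list \<Rightarrow> int \<Rightarrow> int \<Rightarrow> int \<Rightarrow> int \<Rightarrow> vl \<Rightarrow> int" where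
  "lpd n a b c d e s pre y post s' p q r t = (case t of Z \<Rightarrow> - lp n a b c d e s (y # pre) post
     | V x \<Rightarrow> lpe n a b c d e s pre y post s' p q r x (chk (y + e)))"
definition lpc :: "nat \<Rightarrow> int \<Rightarrow> int \<Rightarrow> int \<Rightarrow> int \<Rightarrow> int \<Rightarrow> int \<Rightarrow> int list \<Rightarrow> int \<Rightarrow> int list \<Rightarrow> int \<Rightarrow> int \<Rightarrow> int \<Rightarrow> vl \<Rightarrow> int" where
  "lpc n a b c d e s pre y post s' p q t = (case t of Z \<Rightarrow> - lp n a b c d e s (y # pre) post
     | V x \<Rightarrow> lpd n a b c d e s pre y post s' p q x (chk (y + d)))"
definition lpb :: "nat \<Rightarrow> int \<Rightarrow> int \<Rightarrow> int \<Rightarrow> int \<Rightarrow> int \<Rightarrow> int \<Rightarrow> int list \<Rightarrow> int \<Rightarrow> int list \<Rightarrow> int \<Rightarrow> int \<Rightarrow> vl \<Rightarrow> int" where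
  "lpb n a b c d e s pre y post s' p t = (case t of Z \<Rightarrow> - lp n a b c d e s (y # pre) post
     | V x \<Rightarrow> lpc n a b c d e s pre y post s' p x (chk (y + c)))"
definition lpa :: "nat \<Rightarrow> int \<Rightarrow> int \<Rightarrow> int \<Rightarrow> int \<Rightarrow> int \<Rightarrow> int \<Rightarrow> int list \<Rightarrow> int \<Rightarrow> int list \<Rightarrow> int \<Rightarrow> vl \<Rightarrow> int" where
  "lpa n a b c d e s pre y post s' t = (case t of Z \<Rightarrow> - lp n a b c d e s (y # pre) post
     | V x \<Rightarrow> lpb n a b c d e s pre y post s' x (chk (y + b)))"
definition lps :: "nat \<Rightarrow> int \<Rightarrow> int \<Rightarrow> int \<Rightarrow> int \<Rightarrow> int \<Rightarrow> int \<Rightarrow> int list \<Rightarrow> int \<Rightarrow> int list \<Rightarrow> vl \<Rightarrow> int" where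
  "lps n a b c d e s pre y post t = (case t of Z \<Rightarrow> - lp n a b c d e s (y # pre) post
     | V x \<Rightarrow> lpa n a b c d e s pre y post x (chk (y + a)))"

lemma case_chk: "f 0 = u \<Longrightarrow> case_vl u f (chk x) = f x"
  by (simp add: chk_def)

lemma chk_simps:
  "pr5 y b c d e (chk x) = x * ((y + b) * ((y + c) * ((y + d) * (y + e))))"
  "pr4 y p c d e (chk x) = p * (x * ((y + c) * ((y + d) * (y + e))))"
  "pr3 y p q d e (chk x) = p * (q * (x * ((y + d) * (y + e))))"
  "lpe n a b c d e s pre y post s' p q r v (chk x) =
     s' * (p * (q * (r * (v * (x * reduced_chain n y p q r v s' (rap pre post)))))) - lp n a b c d e s (y # pre) post"
  "lpd n a b c d e s pre y post s' p q r (chk x) =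
     s' * (p * (q * (r * (x * ((y + e) * reduced_chain n y p q r x s' (rap pre post)))))) - lp n a b c d e s (y # pre) post"
  "lpc n a b c d e s pre y post s' p q (chk x) =
     s' * (p * (q * (x * ((y + d) * ((y + e) * reduced_chain n y p q x (y + d) s' (rap pre post)))))) - lp n a b c d e s (y # pre) post"
  "lpb n a b c d e s pre y post s' p (chk x) =
     s' * (p * (x * ((y + c) * ((y + d) * ((y + e) * reduced_chain n y p x (y + c) (y + d) s' (rap pre post)))))) - lp n a b c d e s (y # pre) post"
  "lpa n a b c d e s pre y post s' (chk x) =
     s' * (x * ((y + b) * ((y + c) * ((y + d) * ((y + e) * reduced_chain n y x (y + b) (y + c) (y + d) s' (rap pre post)))))) - lp n a b c d e s (y # pre) post"
  "lps n a b c d e s pre y post (chk x) =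
     x * ((y + a) * ((y + b) * ((y + c) * ((y + d) * ((y + e) * reduced_chain n y (y + a) (y + b) (y + c) (y + d) x (rap pre post)))))) - lp n a b c d e s (y # pre) post"
  by (simp_all only: pr5_def pr4_def pr3_def lpe_def
    lpd_def lpc_def lpb_def lpa_def lps_def case_chk mult_zero_left mult_zero_right diff_0)

lemma reduced_chain_rules:
  "reduced_chain 0 a b c d e s [x, y] = pr5 x b c d e (chk (x + a)) - pr5 y b c d e (chk (y + a))"
  "reduced_chain (Suc n) a b c d e s xs = lp n a b c d e s [] xs"
  "lp n a b c d e s pre [] = 0"
  "lp n a b c d e s pre (y # post) = lps n a b c d e s pre y post (chk (s - y))"
  "pr5 y b c d e Z = 0"
  "pr5 y b c d e (V v) = pr4 y v c d e (chk (y + b))"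
  "pr4 y p c d e Z = 0"
  "pr4 y p c d e (V v) = pr3 y p v d e (chk (y + c))"
  "pr3 y p q d e Z = 0"
  "pr3 y p q d e (V v) = p * (q * (v * ((y + d) * (y + e))))"
  "lps n a b c d e s pre y post Z = - lp n a b c d e s (y # pre) post"
  "lps n a b c d e s pre y post (V x) = lpa n a b c d e s pre y post x (chk (y + a))"
  "lpa n a b c d e s pre y post s' Z = - lp n a b c d e s (y # pre) post"
  "lpa n a b c d e s pre y post s' (V x) = lpb n a b c d e s pre y post s' x (chk (y + b))"
  "lpb n a b c d e s pre y post s' p Z = - lp n a b c d e s (y # pre) post"
  "lpb n a b c d e s pre y post s' p (V x) = lpc n a b c d e s pre y post s' p x (chk (y + c))"
  "lpc n a b c d e s pre y post s' p q Z = - lp n a b c d e s (y # pre) post"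
  "lpc n a b c d e s pre y post s' p q (V x) = lpd n a b c d e s pre y post s' p q x (chk (y + d))"
  "lpd n a b c d e s pre y post s' p q r Z = - lp n a b c d e s (y # pre) post"
  "lpd n a b c d e s pre y post s' p q r (V x) = lpe n a b c d e s pre y post s' p q r x (chk (y + e))"
  "lpe n a b c d e s pre y post s' p q r v Z = - lp n a b c d e s (y # pre) post"
  "lpe n a b c d e s pre y post s' p q r v (V x) =
     s' * (p * (q * (r * (v * (x * reduced_chain n y p q r v s' (rap pre post)))))) - lp n a b c d e s (y # pre) post"
proof -
  show "reduced_chain 0 a b c d e s [x, y] = pr5 x b c d e (chk (x + a)) - pr5 y b c d e (chk (y + a))"
    by (simp only: reduced_chain.simps pick.simps chk_simps diff_0_right)
  show "reduced_chain (Suc n) a b c d e s xs = lp n a b c d e s [] xs" "lp n a b c d e s pre [] = 0"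
    by (simp_all only: reduced_chain.simps lp_def rev.simps append.simps pick.simps)
  show "lp n a b c d e s pre (y # post) = lps n a b c d e s pre y post (chk (s - y))"
    by (simp only: chk_simps lp_Cons)
  show "pr5 y b c d e (V v) = pr4 y v c d e (chk (y + b))"
    by (simp only: pr5_def vl.case chk_simps)
  show "pr4 y p c d e (V v) = pr3 y p v d e (chk (y + c))"
    by (simp only: pr4_def vl.case chk_simps)
qed (simp_all only: chk_simps pr5_def pr4_def pr3_def lps_def lpa_def lpb_def lpc_def lpd_def lpe_def vl.case mult.assoc diff_0)

primrec wp :: "int \<Rightarrow> int list \<Rightarrow> int" where
  "wp y [] = 1"
| "wp y (u # us) = (if y + u = 0 then 0 else (y + u) * wp y us)"

lemma wp: "wp y us = (\<Prod>u\<leftarrow>us. y + u)"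
  by (induction us) auto

primrec kp :: "int \<Rightarrow> int list \<Rightarrow> int" where
  "kp y [] = 1"
| "kp y (t # ts) = (if y - t = 0 then 0 else (y - t) * kp y ts)"

lemma kp: "kp y ts = (\<Prod>t\<leftarrow>ts. y - t)"
  by (induction ts) auto

primrec shift :: "nat \<Rightarrow> int \<Rightarrow> int list \<Rightarrow> int list" where
  "shift 0 y us = []"
| "shift (Suc w) y us = (case us of [] \<Rightarrow> [] | u # us \<Rightarrow> (y + u) # shift w y us)"

lemma shift: "shift w y us = take w (map ((+) y) us)"
  by (induction w arbitrary: us) (auto split: list.split)

primrec nw :: "nat \<Rightarrow> int \<Rightarrow> int list \<Rightarrow> int list" where
  "nw 0 y us = []"
| "nw (Suc w) y us = y # shift w y us"

lemma nw: "nw w y us = take w (y # map ((+) y) us)"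
  by (cases w) (auto simp: shift)

text \<open>\<open>t\<close> carries the preceding entry, so the last one is at hand where the list
  ends.\<close>

primrec exr :: "nat \<Rightarrow> int list \<Rightarrow> int \<Rightarrow> int \<Rightarrow> int list" where
  "exr 0 rs t y = rs"
| "exr (Suc w) rs t y = (case rs of [] \<Rightarrow> [t + y] | r # rs \<Rightarrow> r # exr w rs r y)"

lemma exr: "exr w rs t y = (if length rs < w then rs @ [(if rs = [] then t else last rs) + y] else rs)"
  by (induction w arbitrary: rs t) (auto split: list.split)

lemma ext_window_exr: "ext_window w rs y = exr w rs 0 y"
  by (simp add: exr ext_window_def)

definition chl :: "nat \<Rightarrow> int list \<Rightarrow> int list \<Rightarrow> int list \<Rightarrow> int" where
  "chl w us pre post = pick (\<lambda>y r. (\<lambda>y r. wp y us * chain w (nw w y us) r) y (rev pre @ r)) post"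

text \<open>Passing the product as an argument makes the simplifier normalize it before it is tested
  for zero; \<open>enb\<close>, \<open>spb\<close>, \<open>spc\<close> and \<open>evb\<close> serve
  the same purpose.\<close>

definition chb :: "int \<Rightarrow> nat \<Rightarrow> int list \<Rightarrow> int list \<Rightarrow> int" where
  "chb c w us xs = c * chain w us xs"

definition enb :: "nat \<Rightarrow> int \<Rightarrow> int \<Rightarrow> int \<Rightarrow> int \<Rightarrow> int \<Rightarrow> int list \<Rightarrow> int \<Rightarrow> int \<Rightarrow> int" where
  "enb n a b c d e xs s t = t * reduced_chain n a b c d e s xs"

definition ent :: "int list \<Rightarrow> nat \<Rightarrow> int \<Rightarrow> int \<Rightarrow> int \<Rightarrow> int \<Rightarrow> int \<Rightarrow> int list \<Rightarrow> int \<Rightarrow> int" where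
  "ent us n a b c d e xs s = enb n a b c d e xs s (wp s us)"

lemma chain_ent:
  assumes "length xs = n + 2" "n \<le> 4"
  shows "chain 5 [a, b, c, d, e] xs = ent (take (5 - n) [0, a, b, c, d]) n a b c d e xs (sum_list xs)"
  by (simp only: chain_reduced_chain[OF assms] ent_def enb_def wp)

text \<open>Window sizes are towers of \<open>Suc\<close>, the form that
  \<open>eval_nat_numeral\<close> produces. A full window with more than six elements left does not
  arise in the instances.\<close>

lemma chain_list_rules:
  "chain w us [] = 1"
  "chain w [] (x # xs) = chl w [] [] (x # xs)"
  "chain w [u1] (x # xs) = chl w [u1] [] (x # xs)"
  "chain w [u1, u2] (x # xs) = chl w [u1, u2] [] (x # xs)"
  "chain w [u1, u2, u3] (x # xs) = chl w [u1, u2, u3] [] (x # xs)"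
  "chain w [u1, u2, u3, u4] (x # xs) = chl w [u1, u2, u3, u4] [] (x # xs)"
  "chain (Suc (Suc (Suc (Suc (Suc 0))))) [a, b, c, d, e] [x1] = wp x1 [a, b, c, d, e]"
  "chain (Suc (Suc (Suc (Suc (Suc 0))))) [a, b, c, d, e] [x1, x2] = ent [0, a, b, c, d] 0 a b c d e [x1, x2] (x1 + x2)"
  "chain (Suc (Suc (Suc (Suc (Suc 0))))) [a, b, c, d, e] [x1, x2, x3] =
     ent [0, a, b, c] (Suc 0) a b c d e [x1, x2, x3] (x1 + (x2 + x3))"
  "chain (Suc (Suc (Suc (Suc (Suc 0))))) [a, b, c, d, e] [x1, x2, x3, x4] =
     ent [0, a, b] (Suc (Suc 0)) a b c d e [x1, x2, x3, x4] (x1 + (x2 + (x3 + x4)))"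
  "chain (Suc (Suc (Suc (Suc (Suc 0))))) [a, b, c, d, e] [x1, x2, x3, x4, x5] =
     ent [0, a] (Suc (Suc (Suc 0))) a b c d e [x1, x2, x3, x4, x5] (x1 + (x2 + (x3 + (x4 + x5))))"
  "chain (Suc (Suc (Suc (Suc (Suc 0))))) [a, b, c, d, e] [x1, x2, x3, x4, x5, x6] =
     ent [0] (Suc (Suc (Suc (Suc 0)))) a b c d e [x1, x2, x3, x4, x5, x6] (x1 + (x2 + (x3 + (x4 + (x5 + x6)))))"
  "ent us n a b c d e xs s = enb n a b c d e xs s (wp s us)"
  "enb n a b c d e xs s t = (if t = 0 then 0 else t * reduced_chain n a b c d e s xs)"
  "chl w us pre [] = 0"
  "chl w us pre (y # post) = chb (wp y us) w (nw w y us) (rap pre post) - chl w us (y # pre) post"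
  "chb c w us xs = (if c = 0 then 0 else c * chain w us xs)"
proof -
  have *: "chain w us (x # xs) = chl w us [] (x # xs)" for us x xs
    unfolding chl_def by (subst chain_pick) (simp_all add: wp nw)
  show "chain w [] (x # xs) = chl w [] [] (x # xs)"
    "chain w [u1] (x # xs) = chl w [u1] [] (x # xs)"
    "chain w [u1, u2] (x # xs) = chl w [u1, u2] [] (x # xs)"
    "chain w [u1, u2, u3] (x # xs) = chl w [u1, u2, u3] [] (x # xs)"
    "chain w [u1, u2, u3, u4] (x # xs) = chl w [u1, u2, u3, u4] [] (x # xs)"
    by (rule *)+
  show "chl w us pre (y # post) = chb (wp y us) w (nw w y us) (rap pre post) - chl w us (y # pre) post"
    unfolding chl_def by (subst pick_loop) (simp add: chb_def)
  show "chain (Suc (Suc (Suc (Suc (Suc 0))))) [a, b, c, d, e] [x1] = wp x1 [a, b, c, d, e]"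
    by (simp add: chain_def wp del: wp.simps)
  show "chain (Suc (Suc (Suc (Suc (Suc 0))))) [a, b, c, d, e] [x1, x2] = ent [0, a, b, c, d] 0 a b c d e [x1, x2] (x1 + x2)"
    using chain_ent[of "[x1, x2]" 0 a b c d e] by (simp add: numeral_eq_Suc)
  show "chain (Suc (Suc (Suc (Suc (Suc 0))))) [a, b, c, d, e] [x1, x2, x3] =
     ent [0, a, b, c] (Suc 0) a b c d e [x1, x2, x3] (x1 + (x2 + x3))"
    using chain_ent[of "[x1, x2, x3]" 1 a b c d e] by (simp add: numeral_eq_Suc)
  show "chain (Suc (Suc (Suc (Suc (Suc 0))))) [a, b, c, d, e] [x1, x2, x3, x4] =
     ent [0, a, b] (Suc (Suc 0)) a b c d e [x1, x2, x3, x4] (x1 + (x2 + (x3 + x4)))"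
    using chain_ent[of "[x1, x2, x3, x4]" 2 a b c d e] by (simp add: numeral_eq_Suc)
  show "chain (Suc (Suc (Suc (Suc (Suc 0))))) [a, b, c, d, e] [x1, x2, x3, x4, x5] =
     ent [0, a] (Suc (Suc (Suc 0))) a b c d e [x1, x2, x3, x4, x5] (x1 + (x2 + (x3 + (x4 + x5))))"
    using chain_ent[of "[x1, x2, x3, x4, x5]" 3 a b c d e] by (simp add: numeral_eq_Suc)
  show "chain (Suc (Suc (Suc (Suc (Suc 0))))) [a, b, c, d, e] [x1, x2, x3, x4, x5, x6] =
     ent [0] (Suc (Suc (Suc (Suc 0)))) a b c d e [x1, x2, x3, x4, x5, x6] (x1 + (x2 + (x3 + (x4 + (x5 + x6)))))"
    using chain_ent[of "[x1, x2, x3, x4, x5, x6]" 4 a b c d e] by (simp add: numeral_eq_Suc)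
  show "ent us n a b c d e xs s = enb n a b c d e xs s (wp s us)" by (simp add: ent_def)
qed (simp_all add: chain_Nil chl_def chb_def enb_def)

primrec sg :: "nat \<Rightarrow> int \<Rightarrow> int" where
  "sg 0 x = x" | "sg (Suc n) x = - sg n x"

lemma sg: "sg n x = (- 1) ^ n * x"
  by (induction n) auto

primrec sl :: "int list \<Rightarrow> int" where
  "sl [] = 0" | "sl (x # xs) = x + sl xs"

lemma sl: "sl xs = sum_list xs"
  by (induction xs) auto

definition spl :: "nat \<Rightarrow> int \<Rightarrow> int \<Rightarrow> int list \<Rightarrow> int list \<Rightarrow> nat \<Rightarrow> int list \<Rightarrow> int list \<Rightarrow> int list \<Rightarrow> int" where
  "spl w g s ls rs a ps qs xs = split_sum a (\<lambda>ys zs. (s + g * sum_list (rev ps @ ys)) * (chain w ls (rev ps @ ys) * chain w rs (rev qs @ zs))) xs"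

definition spc :: "int \<Rightarrow> int \<Rightarrow> int list \<Rightarrow> int \<Rightarrow> int \<Rightarrow> int" where
  "spc g s ys c d = (s + g * sum_list ys) * (c * d)"

definition spb :: "nat \<Rightarrow> int \<Rightarrow> int \<Rightarrow> int list \<Rightarrow> int list \<Rightarrow> int list \<Rightarrow> int \<Rightarrow> int" where
  "spb w g s rs ys zs c = spc g s ys c (chain w rs zs)"

lemma split_rules:
  "walk_sum_split w a g s ls rs xs = (if g = 0 then (if s = 0 then 0 else s * spl w 0 1 ls rs a [] [] xs) else spl w g s ls rs a [] [] xs)"
  "spl w g s ls rs 0 ps qs xs = spb w g s rs (rap ps []) (rap qs xs) (chain w ls (rap ps []))"
  "spl w g s ls rs (Suc a) ps qs [] = 0"
  "spl w g s ls rs (Suc a) ps qs (x # xs) = spl w g s ls rs a (x # ps) qs xs + sg (Suc a) (spl w g s ls rs (Suc a) ps (x # qs) xs)"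
  "spb w g s rs ys zs c = (if c = 0 then 0 else spc g s ys c (chain w rs zs))"
  "spc g s ys c d = (if d = 0 then 0 else if g = 0 then s * (c * d) else (s + g * sl ys) * (c * d))"
  by (simp_all add: walk_sum_split_def spl_def spb_def spc_def rap sg sl split_sum_scale)

definition evl :: "nat \<Rightarrow> side \<Rightarrow> side list \<Rightarrow> int list \<Rightarrow> nat \<Rightarrow> int \<Rightarrow> int \<Rightarrow> int list \<Rightarrow> int \<Rightarrow> int list \<Rightarrow> int list \<Rightarrow> int list \<Rightarrow> int list \<Rightarrow> int" where
  "evl w m ms ks a g q qs s ls rs pre post = pick (\<lambda>y r. (\<lambda>y r. (case m of
      Lt \<Rightarrow> (kp y ks * wp y ls) * walk_sum w ms [] a g qs (s + q * y) (nw w y ls) (exr w rs 0 y) r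
    | Rt \<Rightarrow> (kp y ks * wp y rs) * walk_sum w ms [] a g qs (s + q * y) (exr w ls 0 y) (nw w y rs) r)) y (rev pre @ r)) post"

definition evb :: "int \<Rightarrow> nat \<Rightarrow> side list \<Rightarrow> nat \<Rightarrow> int \<Rightarrow> int list \<Rightarrow> int \<Rightarrow> int list \<Rightarrow> int list \<Rightarrow> int list \<Rightarrow> int" where
  "evb c w ms a g qs s ls rs xs = c * walk_sum w ms [] a g qs s ls rs xs"

lemma walk_sum_rules:
  "walk_sum w [] ks a g qs s ls rs xs = walk_sum_split w a g s ls rs xs"
  "walk_sum w (m # ms) ks a g (q # qs) s ls rs xs = evl w m ms ks a g q qs s ls rs [] xs"
  "evl w m ms ks a g q qs s ls rs pre [] = 0"
  "evl w Lt ms ks a g q qs s ls rs pre (y # post) =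
     evb (kp y ks * wp y ls) w ms a g qs (s + q * y) (nw w y ls) (exr w rs 0 y) (rap pre post)
     - evl w Lt ms ks a g q qs s ls rs (y # pre) post"
  "evl w Rt ms ks a g q qs s ls rs pre (y # post) =
     evb (kp y ks * wp y rs) w ms a g qs (s + q * y) (exr w ls 0 y) (nw w y rs) (rap pre post)
     - evl w Rt ms ks a g q qs s ls rs (y # pre) post"
  "evb c w ms a g qs s ls rs xs = (if c = 0 then 0 else c * walk_sum w ms [] a g qs s ls rs xs)"
proof -
  show "walk_sum w (m # ms) ks a g (q # qs) s ls rs xs = evl w m ms ks a g q qs s ls rs [] xs"
    by (cases m) (simp_all add: evl_def kp wp nw ext_window_exr mult.assoc)
  show "evl w Lt ms ks a g q qs s ls rs pre (y # post) =
     evb (kp y ks * wp y ls) w ms a g qs (s + q * y) (nw w y ls) (exr w rs 0 y) (rap pre post)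
     - evl w Lt ms ks a g q qs s ls rs (y # pre) post"
    unfolding evl_def evb_def by (subst pick_loop) simp
  show "evl w Rt ms ks a g q qs s ls rs pre (y # post) =
     evb (kp y ks * wp y rs) w ms a g qs (s + q * y) (exr w ls 0 y) (nw w y rs) (rap pre post)
     - evl w Rt ms ks a g q qs s ls rs (y # pre) post"
    unfolding evl_def evb_def by (subst pick_loop) simp
qed (simp_all add: evl_def evb_def)

section \<open>Binary arithmetic\<close>

definition mu :: "num \<Rightarrow> num \<Rightarrow> num" where "mu m n = m * n"
definition ad :: "num \<Rightarrow> num \<Rightarrow> num" where "ad m n = m + n"
definition ac :: "num \<Rightarrow> num \<Rightarrow> num" where "ac m n = m + n + num.One"

lemma num_inc: "Num.inc n = n + num.One"
  by (simp add: add_One)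

lemma num_rules:
  "mu num.One n = n" "mu (num.Bit0 m) n = num.Bit0 (mu m n)" "mu (num.Bit1 m) n = ad n (num.Bit0 (mu m n))"
  "ad num.One num.One = num.Bit0 num.One" "ad num.One (num.Bit0 n) = num.Bit1 n" "ad num.One (num.Bit1 n) = num.Bit0 (Num.inc n)"
  "ad (num.Bit0 n) num.One = num.Bit1 n" "ad (num.Bit1 n) num.One = num.Bit0 (Num.inc n)"
  "ad (num.Bit0 num.One) (num.Bit0 n) = num.Bit0 (ad num.One n)" "ad (num.Bit0 m) (num.Bit0 num.One) = num.Bit0 (ad m num.One)"
  "ad (num.Bit0 num.One) (num.Bit1 n) = num.Bit1 (ad num.One n)" "ad (num.Bit0 m) (num.Bit1 num.One) = num.Bit1 (ad m num.One)"
  "ad (num.Bit1 num.One) (num.Bit0 n) = num.Bit1 (ad num.One n)" "ad (num.Bit1 m) (num.Bit0 num.One) = num.Bit1 (ad m num.One)"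
  "ad (num.Bit1 num.One) (num.Bit1 n) = num.Bit0 (ac num.One n)" "ad (num.Bit1 m) (num.Bit1 num.One) = num.Bit0 (ac m num.One)"
  "ad (num.Bit0 (num.Bit0 m)) (num.Bit0 (num.Bit0 n)) = num.Bit0 (num.Bit0 (ad m n))" "ad (num.Bit0 (num.Bit0 m)) (num.Bit1 (num.Bit0 n)) = num.Bit1 (num.Bit0 (ad m n))"
  "ad (num.Bit0 (num.Bit0 m)) (num.Bit0 (num.Bit1 n)) = num.Bit0 (num.Bit1 (ad m n))" "ad (num.Bit0 (num.Bit0 m)) (num.Bit1 (num.Bit1 n)) = num.Bit1 (num.Bit1 (ad m n))"
  "ad (num.Bit1 (num.Bit0 m)) (num.Bit0 (num.Bit0 n)) = num.Bit1 (num.Bit0 (ad m n))" "ad (num.Bit1 (num.Bit0 m)) (num.Bit1 (num.Bit0 n)) = num.Bit0 (num.Bit1 (ad m n))"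
  "ad (num.Bit1 (num.Bit0 m)) (num.Bit0 (num.Bit1 n)) = num.Bit1 (num.Bit1 (ad m n))" "ad (num.Bit1 (num.Bit0 m)) (num.Bit1 (num.Bit1 n)) = num.Bit0 (num.Bit0 (ac m n))"
  "ad (num.Bit0 (num.Bit1 m)) (num.Bit0 (num.Bit0 n)) = num.Bit0 (num.Bit1 (ad m n))" "ad (num.Bit0 (num.Bit1 m)) (num.Bit1 (num.Bit0 n)) = num.Bit1 (num.Bit1 (ad m n))"
  "ad (num.Bit0 (num.Bit1 m)) (num.Bit0 (num.Bit1 n)) = num.Bit0 (num.Bit0 (ac m n))" "ad (num.Bit0 (num.Bit1 m)) (num.Bit1 (num.Bit1 n)) = num.Bit1 (num.Bit0 (ac m n))"
  "ad (num.Bit1 (num.Bit1 m)) (num.Bit0 (num.Bit0 n)) = num.Bit1 (num.Bit1 (ad m n))" "ad (num.Bit1 (num.Bit1 m)) (num.Bit1 (num.Bit0 n)) = num.Bit0 (num.Bit0 (ac m n))"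
  "ad (num.Bit1 (num.Bit1 m)) (num.Bit0 (num.Bit1 n)) = num.Bit1 (num.Bit0 (ac m n))" "ad (num.Bit1 (num.Bit1 m)) (num.Bit1 (num.Bit1 n)) = num.Bit0 (num.Bit1 (ac m n))"
  "ac num.One num.One = num.Bit1 num.One" "ac num.One (num.Bit0 n) = num.Bit0 (Num.inc n)" "ac num.One (num.Bit1 n) = num.Bit1 (Num.inc n)"
  "ac (num.Bit0 n) num.One = num.Bit0 (Num.inc n)" "ac (num.Bit1 n) num.One = num.Bit1 (Num.inc n)"
  "ac (num.Bit0 num.One) (num.Bit0 n) = num.Bit1 (ad num.One n)" "ac (num.Bit0 m) (num.Bit0 num.One) = num.Bit1 (ad m num.One)"
  "ac (num.Bit0 num.One) (num.Bit1 n) = num.Bit0 (ac num.One n)" "ac (num.Bit0 m) (num.Bit1 num.One) = num.Bit0 (ac m num.One)"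
  "ac (num.Bit1 num.One) (num.Bit0 n) = num.Bit0 (ac num.One n)" "ac (num.Bit1 m) (num.Bit0 num.One) = num.Bit0 (ac m num.One)"
  "ac (num.Bit1 num.One) (num.Bit1 n) = num.Bit1 (ac num.One n)" "ac (num.Bit1 m) (num.Bit1 num.One) = num.Bit1 (ac m num.One)"
  "ac (num.Bit0 (num.Bit0 m)) (num.Bit0 (num.Bit0 n)) = num.Bit1 (num.Bit0 (ad m n))" "ac (num.Bit0 (num.Bit0 m)) (num.Bit1 (num.Bit0 n)) = num.Bit0 (num.Bit1 (ad m n))"
  "ac (num.Bit0 (num.Bit0 m)) (num.Bit0 (num.Bit1 n)) = num.Bit1 (num.Bit1 (ad m n))" "ac (num.Bit0 (num.Bit0 m)) (num.Bit1 (num.Bit1 n)) = num.Bit0 (num.Bit0 (ac m n))"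
  "ac (num.Bit1 (num.Bit0 m)) (num.Bit0 (num.Bit0 n)) = num.Bit0 (num.Bit1 (ad m n))" "ac (num.Bit1 (num.Bit0 m)) (num.Bit1 (num.Bit0 n)) = num.Bit1 (num.Bit1 (ad m n))"
  "ac (num.Bit1 (num.Bit0 m)) (num.Bit0 (num.Bit1 n)) = num.Bit0 (num.Bit0 (ac m n))" "ac (num.Bit1 (num.Bit0 m)) (num.Bit1 (num.Bit1 n)) = num.Bit1 (num.Bit0 (ac m n))"
  "ac (num.Bit0 (num.Bit1 m)) (num.Bit0 (num.Bit0 n)) = num.Bit1 (num.Bit1 (ad m n))" "ac (num.Bit0 (num.Bit1 m)) (num.Bit1 (num.Bit0 n)) = num.Bit0 (num.Bit0 (ac m n))"
  "ac (num.Bit0 (num.Bit1 m)) (num.Bit0 (num.Bit1 n)) = num.Bit1 (num.Bit0 (ac m n))" "ac (num.Bit0 (num.Bit1 m)) (num.Bit1 (num.Bit1 n)) = num.Bit0 (num.Bit1 (ac m n))"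
  "ac (num.Bit1 (num.Bit1 m)) (num.Bit0 (num.Bit0 n)) = num.Bit0 (num.Bit0 (ac m n))" "ac (num.Bit1 (num.Bit1 m)) (num.Bit1 (num.Bit0 n)) = num.Bit1 (num.Bit0 (ac m n))"
  "ac (num.Bit1 (num.Bit1 m)) (num.Bit0 (num.Bit1 n)) = num.Bit0 (num.Bit1 (ac m n))" "ac (num.Bit1 (num.Bit1 m)) (num.Bit1 (num.Bit1 n)) = num.Bit1 (num.Bit1 (ac m n))"
  by (simp_all add: mu_def ad_def ac_def num_inc num_eq_iff nat_of_num_add nat_of_num_mult algebra_simps)

lemma int_rules:
  "chk 0 = Z" "chk 1 = V 1" "chk (- 1) = V (- 1)" "chk (numeral n) = V (numeral n)" "chk (- numeral n) = V (- numeral n)"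
  "(0 = (0::int)) = True" "(1 = (0::int)) = False" "(- 1 = (0::int)) = False" "(numeral n = (0::int)) = False" "(- numeral n = (0::int)) = False"
  "(if True then x else y) = (x::int)" "(if False then x else y) = (y::int)"
  "(numeral m :: int) + numeral n = numeral (ad m n)"
  "(numeral m :: int) + - numeral n = Num.sub m n"
  "- numeral m + (numeral n :: int) = Num.sub n m"
  "- (numeral m :: int) + - numeral n = - numeral (ad m n)"
  "1 + 1 = (2::int)" "1 + - 1 = (0::int)" "- 1 + 1 = (0::int)" "- 1 + - 1 = (- 2::int)"
  "0 + x = (x::int)" "x + 0 = (x::int)"
  "numeral m + 1 = (numeral (Num.inc m) :: int)" "1 + numeral m = (numeral (Num.inc m) :: int)"
  "numeral m + - 1 = (Num.sub m num.One :: int)" "- 1 + numeral m = (Num.sub m num.One :: int)"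
  "- numeral m + 1 = (Num.sub num.One m :: int)" "1 + - numeral m = (Num.sub num.One m :: int)"
  "- numeral m + - 1 = - (numeral (Num.inc m) :: int)" "- 1 + - numeral m = - (numeral (Num.inc m) :: int)"
  "(numeral m :: int) - numeral n = Num.sub m n"
  "(numeral m :: int) - - numeral n = numeral (ad m n)"
  "- numeral m - (numeral n :: int) = - numeral (ad m n)"
  "- (numeral m :: int) - - numeral n = Num.sub n m"
  "x - 0 = (x::int)" "0 - x = (- x::int)"
  "1 - 1 = (0::int)" "1 - - 1 = (2::int)" "- 1 - 1 = (- 2::int)" "- 1 - - 1 = (0::int)"
  "numeral m - 1 = (Num.sub m num.One :: int)" "1 - numeral m = (Num.sub num.One m :: int)"
  "numeral m - - 1 = (numeral (Num.inc m) :: int)" "- 1 - numeral m = - (numeral (Num.inc m) :: int)"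
  "- numeral m - 1 = - (numeral (Num.inc m) :: int)" "1 - - numeral m = (numeral (Num.inc m) :: int)"
  "- numeral m - - 1 = (Num.sub num.One m :: int)" "- 1 - - numeral m = (Num.sub m num.One :: int)"
  "(numeral m :: int) * numeral n = numeral (mu m n)"
  "- (numeral m :: int) * numeral n = - numeral (mu m n)"
  "(numeral m :: int) * - numeral n = - numeral (mu m n)"
  "- (numeral m :: int) * - numeral n = numeral (mu m n)"
  "1 * x = (x::int)" "x * 1 = (x::int)" "- 1 * x = (- x::int)" "x * - 1 = (- x::int)"
  "0 * x = (0::int)" "x * 0 = (0::int)" "- (- x) = (x::int)" "- 0 = (0::int)"
  "Num.dbl 0 = (0::int)" "Num.dbl 1 = (2::int)" "Num.dbl (- 1) = (- 2::int)"
  "Num.dbl (numeral k) = (numeral (num.Bit0 k) :: int)" "Num.dbl (- numeral k) = (- numeral (num.Bit0 k) :: int)"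
  "Num.dbl_inc 0 = (1::int)" "Num.dbl_inc 1 = (3::int)" "Num.dbl_inc (- 1) = (- 1::int)"
  "Num.dbl_inc (numeral k) = (numeral (num.Bit1 k) :: int)" "Num.dbl_inc (- numeral k) = (- numeral (Num.BitM k) :: int)"
  "Num.dbl_dec 0 = (- 1::int)" "Num.dbl_dec 1 = (1::int)" "Num.dbl_dec (- 1) = (- 3::int)"
  "Num.dbl_dec (numeral k) = (numeral (Num.BitM k) :: int)" "Num.dbl_dec (- numeral k) = (- numeral (num.Bit1 k) :: int)"
  by (simp_all add: chk_def mu_def ad_def num_inc add_One_commute)

text \<open>Splitting off two bits on each side turns a difference into 4 (m - n) + c with c between
  -3 and 3; this function recombines the parts.\<close>

definition fq :: "int \<Rightarrow> int \<Rightarrow> int" where "fq c x = x + x + (x + x) + c"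

lemma numeral_BitM_int: "(numeral (Num.BitM k) :: int) = numeral k + numeral k - 1"
proof -
  have "numeral (Num.BitM k) + (1 :: int) = numeral k + numeral k"
    using arg_cong[OF BitM_plus_one[of k], of "numeral :: num \<Rightarrow> int"] by (simp only: numeral_add numeral_One numeral_Bit0)
  then show ?thesis by linarith
qed

lemma sub_rules:
  "Num.sub num.One num.One = (0::int)" "Num.sub num.One (num.Bit0 n) = (- numeral (Num.BitM n) :: int)"
  "Num.sub num.One (num.Bit1 n) = (- numeral (num.Bit0 n) :: int)" "Num.sub (num.Bit0 m) num.One = (numeral (Num.BitM m) :: int)"
  "Num.sub (num.Bit1 m) num.One = (numeral (num.Bit0 m) :: int)" "Num.sub (num.Bit0 num.One) (num.Bit0 n) = (Num.dbl (Num.sub num.One n) :: int)"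
  "Num.sub (num.Bit0 m) (num.Bit0 num.One) = (Num.dbl (Num.sub m num.One) :: int)" "Num.sub (num.Bit0 num.One) (num.Bit1 n) = (Num.dbl_dec (Num.sub num.One n) :: int)"
  "Num.sub (num.Bit0 m) (num.Bit1 num.One) = (Num.dbl_dec (Num.sub m num.One) :: int)" "Num.sub (num.Bit1 num.One) (num.Bit0 n) = (Num.dbl_inc (Num.sub num.One n) :: int)"
  "Num.sub (num.Bit1 m) (num.Bit0 num.One) = (Num.dbl_inc (Num.sub m num.One) :: int)" "Num.sub (num.Bit1 num.One) (num.Bit1 n) = (Num.dbl (Num.sub num.One n) :: int)"
  "Num.sub (num.Bit1 m) (num.Bit1 num.One) = (Num.dbl (Num.sub m num.One) :: int)" "Num.sub (num.Bit0 (num.Bit0 m)) (num.Bit0 (num.Bit0 n)) = fq 0 (Num.sub m n)"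
  "Num.sub (num.Bit0 (num.Bit0 m)) (num.Bit1 (num.Bit0 n)) = fq (- 1) (Num.sub m n)" "Num.sub (num.Bit0 (num.Bit0 m)) (num.Bit0 (num.Bit1 n)) = fq (- 2) (Num.sub m n)"
  "Num.sub (num.Bit0 (num.Bit0 m)) (num.Bit1 (num.Bit1 n)) = fq (- 3) (Num.sub m n)" "Num.sub (num.Bit1 (num.Bit0 m)) (num.Bit0 (num.Bit0 n)) = fq 1 (Num.sub m n)"
  "Num.sub (num.Bit1 (num.Bit0 m)) (num.Bit1 (num.Bit0 n)) = fq 0 (Num.sub m n)" "Num.sub (num.Bit1 (num.Bit0 m)) (num.Bit0 (num.Bit1 n)) = fq (- 1) (Num.sub m n)"
  "Num.sub (num.Bit1 (num.Bit0 m)) (num.Bit1 (num.Bit1 n)) = fq (- 2) (Num.sub m n)" "Num.sub (num.Bit0 (num.Bit1 m)) (num.Bit0 (num.Bit0 n)) = fq 2 (Num.sub m n)"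
  "Num.sub (num.Bit0 (num.Bit1 m)) (num.Bit1 (num.Bit0 n)) = fq 1 (Num.sub m n)" "Num.sub (num.Bit0 (num.Bit1 m)) (num.Bit0 (num.Bit1 n)) = fq 0 (Num.sub m n)"
  "Num.sub (num.Bit0 (num.Bit1 m)) (num.Bit1 (num.Bit1 n)) = fq (- 1) (Num.sub m n)" "Num.sub (num.Bit1 (num.Bit1 m)) (num.Bit0 (num.Bit0 n)) = fq 3 (Num.sub m n)"
  "Num.sub (num.Bit1 (num.Bit1 m)) (num.Bit1 (num.Bit0 n)) = fq 2 (Num.sub m n)" "Num.sub (num.Bit1 (num.Bit1 m)) (num.Bit0 (num.Bit1 n)) = fq 1 (Num.sub m n)"
  "Num.sub (num.Bit1 (num.Bit1 m)) (num.Bit1 (num.Bit1 n)) = fq 0 (Num.sub m n)" "fq (- 3) 0 = - 3"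
  "fq (- 3) 1 = 1" "fq (- 3) (- 1) = - 7"
  "fq (- 3) (numeral k) = numeral (Num.BitM (Num.BitM k))" "fq (- 3) (- numeral k) = - numeral (num.Bit1 (num.Bit1 k))"
  "fq (- 2) 0 = - 2" "fq (- 2) 1 = 2"
  "fq (- 2) (- 1) = - 6" "fq (- 2) (numeral k) = numeral (num.Bit0 (Num.BitM k))"
  "fq (- 2) (- numeral k) = - numeral (num.Bit0 (num.Bit1 k))" "fq (- 1) 0 = - 1"
  "fq (- 1) 1 = 3" "fq (- 1) (- 1) = - 5"
  "fq (- 1) (numeral k) = numeral (num.Bit1 (Num.BitM k))" "fq (- 1) (- numeral k) = - numeral (num.Bit1 (num.Bit0 k))"
  "fq 0 0 = 0" "fq 0 1 = 4"
  "fq 0 (- 1) = - 4" "fq 0 (numeral k) = numeral (num.Bit0 (num.Bit0 k))"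
  "fq 0 (- numeral k) = - numeral (num.Bit0 (num.Bit0 k))" "fq 1 0 = 1"
  "fq 1 1 = 5" "fq 1 (- 1) = - 3"
  "fq 1 (numeral k) = numeral (num.Bit1 (num.Bit0 k))" "fq 1 (- numeral k) = - numeral (num.Bit1 (Num.BitM k))"
  "fq 2 0 = 2" "fq 2 1 = 6"
  "fq 2 (- 1) = - 2" "fq 2 (numeral k) = numeral (num.Bit0 (num.Bit1 k))"
  "fq 2 (- numeral k) = - numeral (num.Bit0 (Num.BitM k))" "fq 3 0 = 3"
  "fq 3 1 = 7" "fq 3 (- 1) = - 1"
  "fq 3 (numeral k) = numeral (num.Bit1 (num.Bit1 k))" "fq 3 (- numeral k) = - numeral (Num.BitM (Num.BitM k))"
  unfolding fq_def Num.sub_def Num.dbl_def Num.dbl_inc_def Num.dbl_dec_def numeral_BitM_int numeral_Bit0 numeral_Bit1 numeral_One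
  by (linarith | simp)+

lemmas eval_rules = reduced_chain_rules chain_list_rules split_rules walk_sum_rules
  rap.simps wp.simps kp.simps shift.simps nw.simps exr.simps sg.simps sl.simps list.case
  num_rules int_rules sub_rules Num.inc.simps BitM.simps numeral_One[where 'a = int]
  eval_nat_numeral One_nat_def

section \<open>Completing a partial ordering\<close>

text \<open>Because all constant terms and all sets \<open>xs\<close> are quantified here, one
  numerical evaluation serves every middle part whose windows have \<open>nl\<close> and
  \<open>nr\<close> entries.\<close>

definition completable :: "nat \<Rightarrow> side list \<Rightarrow> nat \<Rightarrow> nat \<Rightarrow> int \<Rightarrow> bool" where
  "completable w ms nl nr p \<longleftrightarrow> (\<forall>fs xs. mset (map fst fs) = mset (supports w ms 0 (replicate nl []) (replicate nr [])) \<longrightarrow>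
     length xs = length ms \<longrightarrow> (\<forall>i<length xs. \<forall>j<i. \<not> p dvd xs ! i - xs ! j) \<longrightarrow>
     (\<exists>l. mset l = mset xs \<and> (\<forall>x\<in>set fs. \<not> p dvd item_val l x)))"

lemma completable_walk_sum:
  fixes p :: int
  assumes p: "prime p" and walk_sum: "walk_sum w core ks a \<gamma> qs 0 lu ru A = N" and N: "\<not> p dvd N"
    and ms: "ms = core @ replicate a Lt @ replicate b Rt" and A: "length A = length ms"
    and core: "core \<noteq> []" and qs: "length qs = length core"
    and window: "a = 0 \<or> w \<le> length lu + length core + a \<and> w \<le> length ru + length core"
    and nl: "nl = length lu" and nr: "nr = length ru"
    and sz: "2 * (Suc (length ks) + length (supports w ms 0 (replicate nl []) (replicate nr []))) = length A * (length A - 1)"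
  shows "completable w ms nl nr p"
proof -
  define n where "n = length ms"
  have n': "n = length core + a + b" by (simp add: n_def ms)
  then have pos: "0 < n" using core by simp
  \<comment> \<open>The padding up to degree n (n - 1) / 2: the factors for \<open>ks\<close> and
    the weight form, which the \<open>Suc\<close> in the size assumption accounts for.\<close>
  define es where "es = map (\<lambda>t. (cf [0], - t)) ks @ [(weight_coeff qs \<gamma> a, 0)]"
  have es: "prodform n es l = (\<Prod>t\<leftarrow>ks. l ! 0 - t) * weight qs 0 \<gamma> a l" if "length l = n" for l
  proof -
    have "linform n (cf [0]) l = l ! 0" using linform_cf[of "[0]" n l] pos by simp
    then have 1: "prodform n (map (\<lambda>t. (cf [0], - t)) ks) l = (\<Prod>t\<leftarrow>ks. l ! 0 - t)"
      by (simp add: prodform_def o_def)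
    have 2: "prodform n [(weight_coeff qs \<gamma> a, 0)] l = weight qs 0 \<gamma> a l"
      using weight_linform[of qs a l 0 \<gamma>] that n' qs by (simp add: prodform_def)
    show ?thesis unfolding es_def prodform_append 1 2 ..
  qed
  have An: "length A = n" using A n_def by simp
  have "signed_sum n (\<lambda>l. prodform n es l * walk w ms lu ru l) A = N"
  proof -
    have "signed_sum n (\<lambda>l. prodform n es l * walk w ms lu ru l) A
      = signed_sum n (\<lambda>l. ((\<Prod>t\<leftarrow>ks. l ! 0 - t) * weight qs 0 \<gamma> a l) * walk w ms lu ru l) A"
      by (rule signed_sum_cong[OF _ An]) (use es An in \<open>auto dest: mset_eq_length\<close>)
    also have "\<dots> = walk_sum w core ks a \<gamma> qs 0 lu ru A"
      unfolding n' ms by (rule signed_sum_walk_sum) (use An core qs window n' in auto)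
    finally show ?thesis using walk_sum by simp
  qed
  then have signed_sum: "\<not> p dvd signed_sum n (\<lambda>l. prodform n es l * walk w ms lu ru l) A" using N by simp
  have sz': "length es + length (supports w ms 0 (replicate (length lu) []) (replicate (length ru) [])) = n * (n - 1) div 2"
    using arg_cong[OF sz, of "\<lambda>x. x div 2"] An by (simp add: es_def nl nr)
  show ?thesis
    unfolding completable_def nl nr
  proof (intro allI impI)
    fix fs :: "item list" and xs :: "int list"
    assume fs: "mset (map fst fs) = mset (supports w ms 0 (replicate (length lu) []) (replicate (length ru) []))"
      and xs: "length xs = length ms" "\<forall>i<length xs. \<forall>j<i. \<not> p dvd xs ! i - xs ! j"
    show "\<exists>l. mset l = mset xs \<and> (\<forall>x\<in>set fs. \<not> p dvd item_val l x)"
      by (rule walk_nullstellensatz[OF p n_def sz' An signed_sum fs, of xs]) (use xs n_def in auto)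
  qed
qed

lemma completableD:
  fixes p :: int
  assumes "completable w ms nl nr p" "prime p" "length ls = nl" "length rs = nr"
    and xs: "length xs = length ms" "\<And>i j. i < length xs \<Longrightarrow> j < i \<Longrightarrow> \<not> p dvd xs ! i - xs ! j"
  obtains l where "mset l = mset xs" "\<not> p dvd walk w ms ls rs l"
proof -
  let ?fs = "factors w ms 0 (map (Pair []) ls) (map (Pair []) rs)"
  have "mset (map fst ?fs) = mset (supports w ms 0 (replicate nl []) (replicate nr []))"
    using assms(3,4) by (simp add: map_fst_factors o_def map_replicate_const)
  then obtain l where l: "mset l = mset xs" "\<And>x. x \<in> set ?fs \<Longrightarrow> \<not> p dvd item_val l x"
    using assms(1) xs unfolding completable_def by blast
  have "length l = length ms" using l(1) xs(1) mset_eq_length by metis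
  then have "walk w ms (map (item_val l) (map (Pair []) ls)) (map (item_val l) (map (Pair []) rs)) (drop 0 l) = (\<Prod>x\<leftarrow>?fs. item_val l x)"
    by (intro walk_factors) simp
  then have w: "walk w ms ls rs l = (\<Prod>x\<leftarrow>?fs. item_val l x)"
    by (simp add: o_def item_val_def)
  have "\<not> p dvd (\<Prod>x\<leftarrow>fs'. item_val l x)" if "set fs' \<subseteq> set ?fs" for fs'
    using that l(2) assms(2) by (induction fs') (auto simp: prime_dvd_mult_iff)
  then show ?thesis using that[OF l(1)] w by simp
qed

text \<open>
  The factor of the first left move that comes from the first entry \<open>hd ls\<close> of the window may be left out of the
  product (whence \<open>Suc n = w\<close>) if it cannot vanish anyway.
\<close>

lemma completableD_closed:
  fixes p :: int
  assumes "completable w (Lt # ms) n nr p" "prime p" "Suc n = w" "length ls = w" "length rs = nr" "w \<le> nr"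
    and xs: "length xs = Suc (length ms)" "\<And>i j. i < length xs \<Longrightarrow> j < i \<Longrightarrow> \<not> p dvd xs ! i - xs ! j"
    and closed: "\<And>x. x \<in> set xs \<Longrightarrow> \<not> p dvd x + hd ls"
  obtains l where "mset l = mset xs" "\<not> p dvd walk w (Lt # ms) ls rs l"
proof -
  obtain u us where ls: "ls = u # us" using assms(3,4) by (cases ls) auto
  let ?I = "map (Pair [] :: int \<Rightarrow> item)"
  let ?gs = "factors w (Lt # ms) 0 (?I ls) (?I rs)"
  define fs where "fs = map (addv 0) (?I us) @ factors w ms (Suc 0) (take w (([0], 0) # map (addv 0) (?I ls))) (fext w (?I rs) 0)"
  have gs: "?gs = addv 0 ([], u) # fs" by (simp add: fs_def ls)
  have 1: "map fst (map (addv 0) (?I us)) = replicate n [0]" "map fst (map (addv 0) (?I ls)) = replicate w [0]"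
  proof -
    have "w = Suc (length us)" "n = length us" using assms(3,4) ls by auto
    then show "map fst (map (addv 0) (?I us)) = replicate n [0]" "map fst (map (addv 0) (?I ls)) = replicate w [0]"
      using ls by (simp_all add: o_def addv_def map_replicate_const)
  qed
  have 2: "fext w (?I rs) 0 = ?I rs" using assms(5,6) by (simp add: fext_def)
  have "map fst (?I rs) = replicate nr []" using assms(5) by (simp add: o_def map_replicate_const)
  then have "map fst fs = replicate n [0] @ supports w ms (Suc 0) (take w ([0] # replicate w [0])) (replicate nr [])"
    by (simp only: fs_def map_append map_fst_factors 2 take_map[symmetric] list.map(2) 1 fst_conv)
  moreover have "supports w (Lt # ms) 0 (replicate n []) (replicate nr []) =
      replicate n [0] @ supports w ms (Suc 0) (take w ([0] # replicate n [0])) (replicate nr [])"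
    using assms(5,6) by (simp add: sext_def)
  \<comment> \<open>All initial window entries have the same empty support, so leaving one out
    changes only their number; after the first left move the cut at \<open>w\<close> entries hides
    even that.\<close>
  moreover have "take w ([0::nat] # replicate w [0]) = take w ([0] # replicate n [0])"
    unfolding assms(3)[symmetric] by (simp add: min_def del: replicate_Suc)
  ultimately have "mset (map fst fs) = mset (supports w (Lt # ms) 0 (replicate n []) (replicate nr []))" by simp
  then obtain l where l: "mset l = mset xs" "\<And>x. x \<in> set fs \<Longrightarrow> \<not> p dvd item_val l x"
    using assms(1)[unfolded completable_def, rule_format, of fs xs] xs by auto
  have len: "length l = Suc (length ms)" using l(1) xs(1) mset_eq_length by metis
  then have "walk w (Lt # ms) (map (item_val l) (?I ls)) (map (item_val l) (?I rs)) (drop 0 l) = (\<Prod>x\<leftarrow>?gs. item_val l x)"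
    by (intro walk_factors) simp
  then have w: "walk w (Lt # ms) ls rs l = (\<Prod>x\<leftarrow>?gs. item_val l x)"
    by (simp add: o_def item_val_def del: walk.simps)
  have "l ! 0 \<in> set xs" using l(1) len by (metis mset_eq_setD nth_mem zero_less_Suc)
  then have "\<not> p dvd item_val l (addv 0 ([], u))"
    using closed[of "l ! 0"] ls by (simp add: item_val_def addv_def)
  then have "\<not> p dvd item_val l x" if "x \<in> set ?gs" for x
    using that l(2)[of x] unfolding gs by (cases "x = addv 0 ([], u)") simp_all
  then have "\<not> p dvd (\<Prod>x\<leftarrow>gs'. item_val l x)" if "set gs' \<subseteq> set ?gs" for gs'
    using that assms(2) by (induction gs') (auto simp: prime_dvd_mult_iff simp del: factors.simps)
  from this[OF order_refl] show ?thesis by (intro that[OF l(1)]) (simp only: w not_False_eq_True)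
qed

text \<open>The three alternatives match the points: n consecutive integers have differences below
  n, so the primes 5 and 7 are unavoidable in the evaluated number only from 6 and 8 points
  on.\<close>

lemma not_dvd_smooth:
  fixes p :: int
  assumes "prime p" "7 < p \<or> 5 < p \<and> d = 0 \<or> 3 < p \<and> c = 0 \<and> d = 0"
  shows "\<not> p dvd 2 ^ a * 3 ^ b * 5 ^ c * 7 ^ d"
proof
  have *: "\<not> p dvd q" if "0 < q" "q < p" for q
    using that by (meson zdvd_not_zless)
  assume "p dvd 2 ^ a * 3 ^ b * 5 ^ c * 7 ^ d"
  then have "p dvd 2 ^ a \<or> p dvd 3 ^ b \<or> p dvd 5 ^ c \<or> p dvd 7 ^ d"
    using assms(1) by (auto simp: prime_dvd_mult_iff)
  moreover have "p dvd q \<and> n \<noteq> 0" if "p dvd q ^ n" for q :: int and n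
    using that assms(1) prime_dvd_power[of p q n] by (cases n) (auto simp: not_prime_unit)
  ultimately have "p dvd 2 \<or> p dvd 3 \<or> p dvd 5 \<and> c \<noteq> 0 \<or> p dvd 7 \<and> d \<noteq> 0"
    by blast
  then show False using assms(2) * by auto
qed

section \<open>The greedy middle part and its completion\<close>

lemma distinct_mod:
  fixes p :: int
  assumes "distinct xs" "set xs \<subseteq> {1..<p}" "i < length xs" "j < i"
  shows "\<not> p dvd xs ! i - xs ! j"
proof
  assume "p dvd xs ! i - xs ! j"
  moreover have "xs ! i \<in> {1..<p}" "xs ! j \<in> {1..<p}"
    using assms nth_mem[of i xs] nth_mem[of j xs] by (meson order.strict_trans subsetD)+
  ultimately have "xs ! i = xs ! j"
    by (auto simp flip: mod_eq_dvd_iff)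
  then show False using assms by (auto simp: nth_eq_iff_index_eq)
qed

text \<open>A new right end must avoid at most five residues, the negated window sums. Since
  \<open>m + 5 \<le> card A\<close>, at least six candidates are left before each step.\<close>

lemma extend:
  fixes p :: int
  assumes "finite A" "A \<subseteq> {1..<p}" "block_free 5 p s" "distinct s" "set s \<subseteq> A" "length s \<le> m" "m + 5 \<le> card A"
  shows "\<exists>s'. block_free 5 p (s @ s') \<and> distinct (s @ s') \<and> set (s @ s') \<subseteq> A \<and> length (s @ s') = m"
proof -
  have "\<exists>s'. block_free 5 p (s @ s') \<and> distinct (s @ s') \<and> set (s @ s') \<subseteq> A \<and> length (s @ s') = length s + d"
    if "length s + d + 5 \<le> card A" for d
    using that
  proof (induction d)
    case 0
    then show ?case using assms by (intro exI[of _ "[]"]) auto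
  next
    case (Suc d)
    then obtain s' where s': "block_free 5 p (s @ s')" "distinct (s @ s')" "set (s @ s') \<subseteq> A" "length (s @ s') = length s + d"
      by auto
    let ?W = "(\<lambda>u. (- u) mod p) ` set (window 5 (rev (s @ s')))"
    have "card ?W \<le> 5"
      by (rule order.trans[OF card_image_le]) (auto intro: order.trans[OF card_length])
    moreover have "card (A - set (s @ s')) = card A - (length s + d)"
      using s' assms(1) by (metis card_Diff_subset List.finite_set distinct_card)
    ultimately have "card ?W < card (A - set (s @ s'))" using Suc.prems by simp
    then have "\<not> A - set (s @ s') \<subseteq> ?W"
      by (meson List.finite_set card_mono finite_imageI linorder_not_le)
    then obtain y where y: "y \<in> A - set (s @ s')" "y \<notin> ?W" by blast
    have "block_free 5 p (y # rev (s @ s'))"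
    proof (rule block_free_Cons)
      show "block_free 5 p (rev (s @ s'))" using s'(1) by (simp only: block_free_rev)
      fix u assume u: "u \<in> set (window 5 (rev (s @ s')))"
      show "\<not> p dvd y + u"
      proof
        assume "p dvd y + u"
        then have "y mod p = (- u) mod p" by (simp add: mod_eq_dvd_iff)
        moreover have "y mod p = y" using y(1) assms(2) by auto
        ultimately show False using y(2) u by auto
      qed
    qed
    then have "block_free 5 p (s @ s' @ [y])"
      by (metis append_assoc block_free_rev rev.simps(2) rev_rev_ident)
    then show ?case using s' y(1) by (intro exI[of _ "s' @ [y]"]) auto
  qed
  from this[of "m - length s"] show ?thesis using assms(6,7) by auto
qed

text \<open>How \<open>mid\<close> and \<open>B\<close> are related is left to the caller; this
  admits \<open>[0]\<close> as a middle part although 0 is not in the set.\<close>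

lemma complete_build:
  fixes p :: int
  assumes "completable w ms (min w (length mid)) (min w (length mid)) p" "prime p"
    "block_free w p mid" "finite B" "B \<subseteq> {1..<p}" "card B = length ms"
  obtains l where "mset l = mset (sorted_list_of_set B)" "block_free w p (build ms mid l)" "length l = length ms"
proof -
  define xs where "xs = sorted_list_of_set B"
  have xs: "distinct xs" "set xs = B" "length xs = length ms"
    using assms(4,6) by (simp_all add: xs_def)
  have dm: "\<And>i j. i < length xs \<Longrightarrow> j < i \<Longrightarrow> \<not> p dvd xs ! i - xs ! j"
    by (rule distinct_mod[OF xs(1)]) (use xs assms(5) in auto)
  obtain l where l: "mset l = mset xs" "\<not> p dvd walk w ms (window w mid) (window w (rev mid)) l"
    by (rule completableD[OF assms(1,2) _ _ xs(3) dm]) auto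
  have len: "length l = length ms" using l(1) xs(3) mset_eq_length by metis
  show ?thesis using that[OF _ _ len] l walk_block_free[OF assms(3) l(2) len] by (simp add: xs_def)
qed

lemma complete:
  fixes p :: int
  assumes "completable w ms (min w (length mid)) (min w (length mid)) p" "prime p"
    "block_free w p mid" "distinct mid" "finite A" "set mid \<subseteq> A" "A \<subseteq> {1..<p}" "card A = length mid + length ms"
  shows "\<exists>as. distinct as \<and> set as = A \<and> block_free w p as"
proof -
  let ?B = "A - set mid"
  have "card ?B = length ms" using assms(4-6,8) by (simp add: card_Diff_subset distinct_card)
  then obtain l where l: "mset l = mset (sorted_list_of_set ?B)" "block_free w p (build ms mid l)" "length l = length ms"
    using complete_build[OF assms(1-3), of ?B] assms(5,7) by blast
  have m: "mset (build ms mid l) = mset (mid @ sorted_list_of_set ?B)" using mset_build[OF l(3), of mid] l(1) by simp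
  have "set (build ms mid l) = A" using mset_eq_setD[OF m] assms(5,6) by auto
  moreover have "distinct (build ms mid l)"
    using mset_eq_imp_distinct_iff[OF m] assms(4,5) by simp
  ultimately show ?thesis using l(2) by blast
qed

text \<open>The form left out is the block of the first left element x and \<open>hd mid\<close>.
  Their sum lies strictly between 0 and 2 p, so it is divisible by p only if x = p -
  \<open>hd mid\<close>.\<close>

lemma complete_closed:
  fixes p :: int
  assumes "completable 5 (Lt # ms) 4 5 p" "prime p"
    "block_free 5 p mid" "distinct mid" "finite A" "set mid \<subseteq> A" "A \<subseteq> {1..<p}" "card A = length mid + Suc (length ms)"
    "5 \<le> length mid" "p - hd mid \<notin> A - set mid"
  shows "\<exists>as. distinct as \<and> set as = A \<and> block_free 5 p as"
proof -
  define xs where "xs = sorted_list_of_set (A - set mid)"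
  have xs: "distinct xs" "set xs = A - set mid" "length xs = Suc (length ms)"
    using assms(4-6,8) by (simp_all add: xs_def card_Diff_subset distinct_card)
  have dm: "\<And>i j. i < length xs \<Longrightarrow> j < i \<Longrightarrow> \<not> p dvd xs ! i - xs ! j"
    by (rule distinct_mod[OF xs(1)]) (use xs assms(7) in auto)
  obtain y mid' where mid: "mid = y # mid'" using assms(9) by (cases mid) auto
  have hd: "hd (window 5 mid) = y" by (simp add: mid window_Cons)
  have closed: "\<not> p dvd x + hd (window 5 mid)" if "x \<in> set xs" for x
  proof
    assume "p dvd x + hd (window 5 mid)"
    then have d: "p dvd x + y" by (simp add: hd)
    have "x \<in> {1..<p}" "y \<in> {1..<p}" using that xs(2) assms(6,7) mid by auto
    then have "x + y = p"
      using d zdvd_not_zless[of "x + y" p] zdvd_not_zless[of "x + y - p" p]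
      by (cases "x + y" p rule: linorder_cases) auto
    then have "x = p - hd mid" by (simp add: mid)
    then show False using that xs(2) assms(10) by simp
  qed
  obtain l where l: "mset l = mset xs" "\<not> p dvd walk 5 (Lt # ms) (window 5 mid) (window 5 (rev mid)) l"
    by (rule completableD_closed[OF assms(1,2) _ _ _ _ xs(3) dm closed, where rs = "window 5 (rev mid)"]) (use assms(9) in auto)
  have len: "length l = length (Lt # ms)" using l(1) xs(3) mset_eq_length by (metis length_Cons)
  have m: "mset (build (Lt # ms) mid l) = mset (mid @ xs)" using mset_build[OF len, of mid] l(1) by simp
  have "set (build (Lt # ms) mid l) = A" using mset_eq_setD[OF m] xs(2) assms(6) by auto
  moreover have "distinct (build (Lt # ms) mid l)"
    using mset_eq_imp_distinct_iff[OF m] xs(1,2) assms(4) by auto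
  ultimately show ?thesis using walk_block_free[OF assms(3) l(2) len] by blast
qed

section \<open>Explicit instances\<close>

text \<open>
  The instance with index \<open>k\<close> serves sets of size \<open>k\<close>, except that index 10 also serves size 9 (with the greedy part
  replaced by the fake element 0) and index 16 all larger sizes. The points and the constant terms were found by a
  search that keeps the number of nonvanishing terms small: most orderings contain a vanishing factor. The
  coefficients of the extra linear form are Bezout-like coefficients that make the value a product of primes up to 7
  (up to 5 for index 6, where \<open>p = 7\<close> is possible). For index 16 the left end is adjacent to an element whose negative
  does not occur among the remaining ones, which saves one factor.
\<close>

lemma walk_sum_13: "walk_sum 5 [Lt, Rt, Rt] [- 3, 3, 1, - 4, 0] 4 0 [- 10607298043, 18286778530, 0] 0 [- 4, - 2] [- 2, - 3] [- 4, - 3, - 2, - 1, 0, 1, 2, 3, 4, 5, 6] = 47961943225306417169694720000000"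
  by (simp only: eval_rules refl cong: if_weak_cong)

lemma walk_sum_14: "walk_sum 5 [Rt, Rt] [5, 4] 5 0 [2129434999, - 1349498115] 0 [1, - 5, 2] [2, - 1, 1] [- 5, - 4, - 3, - 2, - 1, 0, 1, 2, 3, 4, 5] = 78305213429071701501542400000000000"
  by (simp only: eval_rules refl cong: if_weak_cong)

lemma walk_sum_15: "walk_sum 5 [Rt] [] 5 (- 1402547897) [3404866642] 0 [1, - 1, - 5, 2] [- 5, 2, 1, 3] [- 5, - 4, - 3, - 2, - 1, 0, 1, 2, 3, 4, 5] = 9135608233391698508513280000000000"
  by (simp only: eval_rules refl cong: if_weak_cong)

lemma walk_sum_11: "walk_sum 5 [Lt, Lt, Rt, Rt] [0, 4, 1, 3] 3 0 [- 8528717, 6998541, 0, 0] 0 [3] [3] [- 5, - 4, - 3, - 2, - 1, 0, 1, 2, 3, 4] = 6450937988382720000000000000"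
  by (simp only: eval_rules refl cong: if_weak_cong)

lemma walk_sum_16: "walk_sum 5 [Lt] [] 5 738716371 [- 13405518717] 0 [- 1, - 2, - 3, 5] [5, - 2, - 3, - 1, 4] [- 5, - 4, - 3, - 2, - 1, 0, 1, 2, 3, 4, 5] = 2397098370277705148006400000000"
  by (simp only: eval_rules refl cong: if_weak_cong)

lemma walk_sum_12: "walk_sum 5 [Lt, Rt, Rt] [] 3 0 [- 9310201, 1240840, 0] 0 [- 1, 1] [1, - 1] [- 4, - 3, - 2, - 1, 0, 1, 2, 3, 4, 5] = 16917793024799441682432000000"
  by (simp only: eval_rules refl cong: if_weak_cong)

lemma walk_sum_10: "walk_sum 5 [Rt, Rt] [] 0 0 [- 1929227, 439042] 0 [1] [1] [- 4, - 3, - 2, - 1, 0, 1, 2, 3, 4] = 19113890335948800000"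
  by (simp only: eval_rules refl cong: if_weak_cong)

lemma walk_sum_8: "walk_sum 5 [Rt, Rt] [- 1, - 3] 0 0 [- 13, 34] 0 [] [] [- 3, - 2, - 1, 0, 1, 2, 3, 4] = 509703742291968000"
  by (simp only: eval_rules refl cong: if_weak_cong)

lemma walk_sum_7: "walk_sum 5 [Rt, Rt] [] 0 0 [- 2, 1] 0 [] [] [- 3, - 2, - 1, 0, 1, 2, 3] = 6718464000"
  by (simp only: eval_rules refl cong: if_weak_cong)

lemma walk_sum_6: "walk_sum 4 [Rt, Rt] [] 0 0 [- 1, 1] 0 [] [] [- 2, - 1, 0, 1, 2, 3] = 414720"
  by (simp only: eval_rules refl cong: if_weak_cong)

lemma walk_sum_5: "walk_sum 3 [Rt, Rt] [] 0 0 [1, 0] 0 [] [] [- 2, - 1, 0, 1, 2] = 1152"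
  by (simp only: eval_rules refl cong: if_weak_cong)

lemma walk_sum_4: "walk_sum 2 [Rt, Rt] [] 0 0 [1, 0] 0 [] [] [- 1, 0, 1, 2] = 12"
  by (simp only: eval_rules refl cong: if_weak_cong)

lemma walk_sum_3: "walk_sum 1 [Rt, Rt] [] 0 0 [1, 0] 0 [] [] [0, 1, 2] = 2"
  by (simp only: eval_rules refl cong: if_weak_cong)

section \<open>Nonvanishing modulo p for each size\<close>

lemma completable_3:
  fixes p :: int
  assumes "prime p" "3 < p"
  shows "completable 1 ([Rt, Rt] @ replicate 0 Lt @ replicate 1 Rt) 0 0 p"
proof (rule completable_walk_sum[OF assms(1) walk_sum_3 _ refl])
  show "\<not> p dvd 2"
    using not_dvd_smooth[OF assms(1), of 0 0 1 0] assms(2) by simp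
qed (simp_all add: eval_nat_numeral sext_def)

lemma completable_4:
  fixes p :: int
  assumes "prime p" "3 < p"
  shows "completable 2 ([Rt, Rt] @ replicate 0 Lt @ replicate 2 Rt) 0 0 p"
proof (rule completable_walk_sum[OF assms(1) walk_sum_4 _ refl])
  show "\<not> p dvd 12"
    using not_dvd_smooth[OF assms(1), of 0 0 2 1] assms(2) by simp
qed (simp_all add: eval_nat_numeral sext_def)

lemma completable_5:
  fixes p :: int
  assumes "prime p" "3 < p"
  shows "completable 3 ([Rt, Rt] @ replicate 0 Lt @ replicate 3 Rt) 0 0 p"
proof (rule completable_walk_sum[OF assms(1) walk_sum_5 _ refl])
  show "\<not> p dvd 1152"
    using not_dvd_smooth[OF assms(1), of 0 0 7 2] assms(2) by simp
qed (simp_all add: eval_nat_numeral sext_def)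

lemma completable_6:
  fixes p :: int
  assumes "prime p" "5 < p"
  shows "completable 4 ([Rt, Rt] @ replicate 0 Lt @ replicate 4 Rt) 0 0 p"
proof (rule completable_walk_sum[OF assms(1) walk_sum_6 _ refl])
  show "\<not> p dvd 414720"
    using not_dvd_smooth[OF assms(1), of 0 1 10 4] assms(2) by simp
qed (simp_all add: eval_nat_numeral sext_def)

lemma completable_7:
  fixes p :: int
  assumes "prime p" "5 < p"
  shows "completable 5 ([Rt, Rt] @ replicate 0 Lt @ replicate 5 Rt) 0 0 p"
proof (rule completable_walk_sum[OF assms(1) walk_sum_7 _ refl])
  show "\<not> p dvd 6718464000"
    using not_dvd_smooth[OF assms(1), of 0 3 13 8] assms(2) by simp
qed (simp_all add: eval_nat_numeral sext_def)

text \<open>The windows start empty, so the blocks number 0 + 1 + 2 + 3 + 4 + 5 + 5 + 5 = 25; two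
  entries of \<open>ks\<close> and the weight form complete 28 = 8 * 7 / 2.\<close>

lemma completable_8:
  fixes p :: int
  assumes "prime p" "7 < p"
  shows "completable 5 ([Rt, Rt] @ replicate 0 Lt @ replicate 6 Rt) 0 0 p"
proof (rule completable_walk_sum[OF assms(1) walk_sum_8 _ refl])
  show "\<not> p dvd 509703742291968000"
    using not_dvd_smooth[OF assms(1), of 3 3 26 11] assms(2) by simp
qed (simp_all add: eval_nat_numeral sext_def)

lemma completable_10:
  fixes p :: int
  assumes "prime p" "7 < p"
  shows "completable 5 ([Rt, Rt] @ replicate 0 Lt @ replicate 7 Rt) 1 1 p"
proof (rule completable_walk_sum[OF assms(1) walk_sum_10 _ refl])
  show "\<not> p dvd 19113890335948800000"
    using not_dvd_smooth[OF assms(1), of 3 5 25 12] assms(2) by simp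
qed (simp_all add: eval_nat_numeral sext_def)

lemma completable_11:
  fixes p :: int
  assumes "prime p" "7 < p"
  shows "completable 5 ([Lt, Lt, Rt, Rt] @ replicate 3 Lt @ replicate 3 Rt) 1 1 p"
proof (rule completable_walk_sum[OF assms(1) walk_sum_11 _ refl])
  show "\<not> p dvd 6450937988382720000000000000"
    using not_dvd_smooth[OF assms(1), of 3 13 30 15] assms(2) by simp
qed (simp_all add: eval_nat_numeral sext_def)

lemma completable_12:
  fixes p :: int
  assumes "prime p" "7 < p"
  shows "completable 5 ([Lt, Rt, Rt] @ replicate 3 Lt @ replicate 4 Rt) 2 2 p"
proof (rule completable_walk_sum[OF assms(1) walk_sum_12 _ refl])
  show "\<not> p dvd 16917793024799441682432000000"
    using not_dvd_smooth[OF assms(1), of 7 6 38 14] assms(2) by simp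
qed (simp_all add: eval_nat_numeral sext_def)

lemma completable_13:
  fixes p :: int
  assumes "prime p" "7 < p"
  shows "completable 5 ([Lt, Rt, Rt] @ replicate 4 Lt @ replicate 4 Rt) 2 2 p"
proof (rule completable_walk_sum[OF assms(1) walk_sum_13 _ refl])
  show "\<not> p dvd 47961943225306417169694720000000"
    using not_dvd_smooth[OF assms(1), of 8 7 38 18] assms(2) by simp
qed (simp_all add: eval_nat_numeral sext_def)

lemma completable_14:
  fixes p :: int
  assumes "prime p" "7 < p"
  shows "completable 5 ([Rt, Rt] @ replicate 5 Lt @ replicate 4 Rt) 3 3 p"
proof (rule completable_walk_sum[OF assms(1) walk_sum_14 _ refl])
  show "\<not> p dvd 78305213429071701501542400000000000"
    using not_dvd_smooth[OF assms(1), of 6 11 45 18] assms(2) by simp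
qed (simp_all add: eval_nat_numeral sext_def)

lemma completable_15:
  fixes p :: int
  assumes "prime p" "7 < p"
  shows "completable 5 ([Rt] @ replicate 5 Lt @ replicate 5 Rt) 4 4 p"
proof (rule completable_walk_sum[OF assms(1) walk_sum_15 _ refl])
  show "\<not> p dvd 9135608233391698508513280000000000"
    using not_dvd_smooth[OF assms(1), of 7 10 43 17] assms(2) by simp
qed (simp_all add: eval_nat_numeral sext_def)

text \<open>With 4 forms for the first move and 5 for each of the other ten there are 54; the weight
  form completes 55 = 11 * 10 / 2.\<close>

lemma completable_16:
  fixes p :: int
  assumes "prime p" "7 < p"
  shows "completable 5 ([Lt] @ replicate 5 Lt @ replicate 5 Rt) 4 5 p"
proof (rule completable_walk_sum[OF assms(1) walk_sum_16 _ refl])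
  show "\<not> p dvd 2397098370277705148006400000000"
    using not_dvd_smooth[OF assms(1), of 4 8 41 19] assms(2) by simp
qed (simp_all add: eval_nat_numeral sext_def)

section \<open>Sequencings\<close>

lemma block_free_Nil [simp]: "block_free w p []"
  by (simp add: block_free_def)

lemma window_Nil [simp]: "window w [] = []"
  by (simp add: window_def)

lemma block_free_single [simp]: "block_free w p [y]"
  by (rule block_free_Cons) (simp_all add: window_def)

lemma block_free_tl: "block_free w p (y # s) \<Longrightarrow> block_free w p s"
  unfolding block_free_def by (metis append_Cons)

text \<open>The three blocks sum to y + z, z - y and z modulo p.\<close>

lemma block_free_inverse_pair:
  fixes p :: int
  assumes "\<not> p dvd y + z" "\<not> p dvd z - y" "\<not> p dvd z"
  shows "block_free w p [y, z, p - y]"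
proof (rule block_free_Cons, rule block_free_Cons, rule block_free_single)
  show "\<not> p dvd z + u" if "u \<in> set (window w [p - y])" for u
  proof -
    have "u = p - y" using that by (cases w) (auto simp: window_Cons)
    moreover have "z + (p - y) = p + (z - y)" by simp
    ultimately show ?thesis using assms(2) by (metis dvd_add_right_iff dvd_refl)
  qed
  show "\<not> p dvd y + u" if "u \<in> set (window w [z, p - y])" for u
  proof -
    have "u \<in> set (take w (z # map ((+) z) (window w [p - y])))" using that by (simp only: window_Cons)
    from in_set_takeD[OF this] have "u = z \<or> u - z \<in> set (window w [p - y])" by auto
    then have "u = z \<or> u = z + (p - y)" by (cases w) (auto simp: window_Cons)
    moreover have "y + (z + (p - y)) = p + z" by simp
    ultimately show ?thesis using assms(1,3) by (auto simp: dvd_add_right_iff)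
  qed
qed

lemma mod_residue_eq:
  fixes p :: int
  assumes "x \<in> {1..<p}" "y \<in> {1..<p}"
  shows "p dvd x + y \<longleftrightarrow> x = p - y" "p dvd x - y \<longleftrightarrow> x = y" "\<not> p dvd x"
proof -
  show "\<not> p dvd x" using assms zdvd_not_zless[of x p] by auto
  show "p dvd x + y \<longleftrightarrow> x = p - y"
    using assms zdvd_not_zless[of "x + y" p] zdvd_not_zless[of "x + y - p" p]
    by (cases "x + y" p rule: linorder_cases) auto
  show "p dvd x - y \<longleftrightarrow> x = y"
    using assms zdvd_not_zless[of "x - y" p] zdvd_not_zless[of "y - x" p]
    by (cases x y rule: linorder_cases) (auto simp: dvd_diff_commute)
qed

text \<open>Blocks of up to min 6 (card A - 1) elements are excluded. The block of all elements has
  to be exempt, since its sum does not depend on the ordering and may be 0.\<close>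

theorem ordering_exists:
  fixes p :: int
  assumes p: "prime p" and A: "A \<subseteq> {1..<p}" and k: "2 \<le> card A"
  shows "\<exists>as. distinct as \<and> set as = A \<and> block_free (min 5 (card A - 2)) p as"
proof -
  have fin: "finite A" using A finite_subset by blast
  have "card A \<le> card {1..<p}" using A by (intro card_mono) auto
  then have kp: "int (card A) < p" using k by simp
  define w where "w = min 5 (card A - 2)"
  have front: "\<exists>as. distinct as \<and> set as = A \<and> block_free 5 p as"
    if ms: "completable 5 ms (min 5 m) (min 5 m) p" "card A = m + length ms" "5 \<le> length ms" for m ms
  proof -
    obtain mid where "block_free 5 p mid" "distinct mid" "set mid \<subseteq> A" "length mid = m"
      using extend[OF fin A, of "[]" m] ms by auto
    then show ?thesis using complete[OF _ p, of 5 ms mid A] ms fin A by simp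
  qed
  have whole: "\<exists>as. distinct as \<and> set as = A \<and> block_free w p as"
    if "completable w ms 0 0 p" "card A = length ms" for ms
    using complete[OF _ p, of w ms "[]" A] that fin A by simp
  have w5: "w = 5" if "7 \<le> card A" using that by (simp add: w_def)
  consider "card A = 2" | "card A = 3" | "card A = 4" | "card A = 5" | "card A = 6" | "card A = 7" | "card A = 8"
    | "card A = 9" | "card A = 10" | "card A = 11" | "card A = 12" | "card A = 13" | "card A = 14" | "card A = 15"
    | "16 \<le> card A" using k by atomize_elim presburger
  then have "\<exists>as. distinct as \<and> set as = A \<and> block_free w p as"
  proof cases
    case 1
    then have "w = 0" by (simp add: w_def)
    \<comment> \<open>For w = 0 block lengths would have to lie between 2 and 1.\<close>
    then show ?thesis using fin by (intro exI[of _ "sorted_list_of_set A"]) (simp add: block_free_def)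
  next
    case 2
    then show ?thesis using whole[OF _, of "[Rt, Rt] @ replicate 0 Lt @ replicate 1 Rt"] completable_3[OF p] kp by (simp add: w_def)
  next
    case 3
    then show ?thesis using whole[OF _, of "[Rt, Rt] @ replicate 0 Lt @ replicate 2 Rt"] completable_4[OF p] kp by (simp add: w_def)
  next
    case 4
    then show ?thesis using whole[OF _, of "[Rt, Rt] @ replicate 0 Lt @ replicate 3 Rt"] completable_5[OF p] kp by (simp add: w_def)
  next
    case 5
    then show ?thesis using whole[OF _, of "[Rt, Rt] @ replicate 0 Lt @ replicate 4 Rt"] completable_6[OF p] kp by (simp add: w_def)
  next
    case 6
    then show ?thesis using whole[OF _, of "[Rt, Rt] @ replicate 0 Lt @ replicate 5 Rt"] completable_7[OF p] kp by (simp add: w_def)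
  next
    case 7
    then show ?thesis using whole[OF _, of "[Rt, Rt] @ replicate 0 Lt @ replicate 6 Rt"] completable_8[OF p] kp by (simp add: w_def)
  next
    case 8
    \<comment> \<open>All nine moves go to the right, so the placeholder 0 stays in front and can be
      removed at the end.\<close>
    let ?ms = "[Rt, Rt] @ replicate 0 Lt @ replicate 7 Rt"
    have "completable 5 ?ms (min 5 (length [0 :: int])) (min 5 (length [0 :: int])) p" using completable_10[OF p] kp 8 by simp
    from complete_build[OF this p block_free_single fin A] 8
    obtain l where l: "mset l = mset (sorted_list_of_set A)" "block_free 5 p (build ?ms [0] l)" "length l = length ?ms"
      by auto
    have "build (replicate n Rt) mid l = mid @ l" if "length l = n" for n mid and l :: "int list"
      using that by (induction n arbitrary: mid l) (auto simp: length_Suc_conv)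
    from this[of l 9 "[0]"] have "build ?ms [0] l = 0 # l" using l(3) by (simp add: eval_nat_numeral)
    then have "block_free 5 p l" using l(2) block_free_tl by metis
    moreover have "set l = A" "distinct l"
      using mset_eq_setD[OF l(1)] mset_eq_imp_distinct_iff[OF l(1)] fin by auto
    ultimately show ?thesis using 8 by (auto simp: w_def)
  next
    case 9
    then show ?thesis using front[of "[Rt, Rt] @ replicate 0 Lt @ replicate 7 Rt" 1] completable_10[OF p] kp w5 by simp
  next
    case 10
    then show ?thesis using front[of "[Lt, Lt, Rt, Rt] @ replicate 3 Lt @ replicate 3 Rt" 1] completable_11[OF p] kp w5 by simp
  next
    case 11
    then show ?thesis using front[of "[Lt, Rt, Rt] @ replicate 3 Lt @ replicate 4 Rt" 2] completable_12[OF p] kp w5 by simp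
  next
    case 12
    then show ?thesis using front[of "[Lt, Rt, Rt] @ replicate 4 Lt @ replicate 4 Rt" 2] completable_13[OF p] kp w5 by simp
  next
    case 13
    then show ?thesis using front[of "[Rt, Rt] @ replicate 5 Lt @ replicate 4 Rt" 3] completable_14[OF p] kp w5 by simp
  next
    case 14
    then show ?thesis using front[of "[Rt] @ replicate 5 Lt @ replicate 5 Rt" 4] completable_15[OF p] kp w5 by simp
  next
    case 15
    let ?ms = "replicate 5 Lt @ replicate 5 Rt"
    have completable: "completable 5 (Lt # ?ms) 4 5 p" using completable_16[OF p] kp 15 by simp
    \<comment> \<open>The extension is made on the right, so \<open>hd s\<close> remains the left
      end. The middle part has card A - 11 elements, at least five, so both windows are
      full.\<close>
    have *: "\<exists>as. distinct as \<and> set as = A \<and> block_free 5 p as"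
      if s: "block_free 5 p s" "distinct s" "set s \<subseteq> A" "length s \<le> 3" "s \<noteq> []" "p - hd s \<notin> A - set s" for s
    proof -
      have "\<exists>s'. block_free 5 p (s @ s') \<and> distinct (s @ s') \<and> set (s @ s') \<subseteq> A \<and> length (s @ s') = card A - 11"
        by (rule extend[OF fin A s(1-3)]) (use 15 s(4) in linarith)+
      then obtain s' where "block_free 5 p (s @ s')" "distinct (s @ s')" "set (s @ s') \<subseteq> A" "length (s @ s') = card A - 11"
        by blast
      then show ?thesis
        using complete_closed[OF completable p, of "s @ s'" A] 15 s(5,6) fin A by simp
    qed
    show ?thesis
    proof (cases "\<exists>y\<in>A. p - y \<notin> A")
      case True
      then obtain y where "y \<in> A" "p - y \<notin> A" by blast
      then show ?thesis using *[of "[y]"] w5 15 by simp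
    next
      \<comment> \<open>Now the set is closed under negation, so the negative of the left end is
        used up within the middle part. It must not follow y directly, whence the separating
        z.\<close>
      case False
      obtain y where y: "y \<in> A" using 15 by fastforce
      have "card {y, p - y} < card A" using 15 by (simp add: card_insert_if)
      then have "\<not> A \<subseteq> {y, p - y}" by (meson card_mono finite.emptyI finite.insertI leD)
      then obtain z where z: "z \<in> A" "z \<noteq> y" "z \<noteq> p - y" by blast
      \<comment> \<open>As p is odd, \<open>y\<close> and \<open>p - y\<close> are distinct
        elements.\<close>
      have "p \<noteq> 2 * y" using prime_odd_int[OF p] kp 15 by auto
      moreover have "block_free 5 p [y, z, p - y]"
      proof -
        have yz: "y \<in> {1..<p}" "z \<in> {1..<p}" using y z A by blast+
        show ?thesis
          using mod_residue_eq[OF yz] mod_residue_eq[OF yz(2,1)] z by (intro block_free_inverse_pair) auto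
      qed
      ultimately show ?thesis using *[of "[y, z, p - y]"] y z False w5 15 by auto
    qed
  qed
  then show ?thesis by (simp add: w_def)
qed

section \<open>Partial sums in the cyclic group\<close>

lemma partial_sum_mod:
  assumes "0 < p" "i \<le> length as" "set as \<subseteq> {0..<int p}"
  shows "partial_sum (integer_mod_group p) as i = sum_list (take i as) mod int p"
proof -
  interpret comm_group "integer_mod_group p" by (rule abelian_integer_mod_group)
  show ?thesis
    using assms(2)
  proof (induction i)
    case 0
    then show ?case by (simp add: partial_sum_def)
  next
    case (Suc i)
    have c: "carrier (integer_mod_group p) = {0..<int p}" using assms(1) by (simp add: carrier_integer_mod_group)
    have "as ! j \<in> carrier (integer_mod_group p)" if "j < Suc i" for j
    proof -
      have "as ! j \<in> set as" using that Suc.prems by simp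
      then show ?thesis using assms(3) c by blast
    qed
    then have "partial_sum (integer_mod_group p) as (Suc i) = as ! i \<otimes>\<^bsub>integer_mod_group p\<^esub> partial_sum (integer_mod_group p) as i"
      unfolding partial_sum_def lessThan_Suc by (intro finprod_insert) auto
    also have "\<dots> = (as ! i + sum_list (take i as) mod int p) mod int p"
      using Suc by (simp add: mult_integer_mod_group)
    also have "\<dots> = sum_list (take (Suc i) as) mod int p"
      using Suc.prems by (simp add: take_Suc_conv_app_nth mod_simps add.commute)
    finally show ?case .
  qed
qed

theorem theorem2p7:
  fixes t p :: nat
  assumes "0 < t" and "t \<le> 6" and "prime p"
  shows "weak_sequenceable_group (integer_mod_group p) t"
  unfolding weak_sequenceable_group_def
proof (intro allI impI, elim conjE)
  let ?G = "integer_mod_group p"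
  fix A :: "int set"
  assume sub: "A \<subseteq> carrier ?G - {\<one>\<^bsub>?G\<^esub>}" and fin: "finite A" and card: "t < card A"
  have p: "0 < p" "prime (int p)" using assms(3) by (simp_all add: prime_gt_0_nat)
  have A: "A \<subseteq> {1..<int p}"
    using sub p(1) by (auto simp: carrier_integer_mod_group)
  have "2 \<le> card A" using card assms(1) by simp
  from ordering_exists[OF p(2) A this] obtain as
    where as: "distinct as" "set as = A" "block_free (min 5 (card A - 2)) (int p) as" by blast
  have len: "length as = card A" using as(1,2) distinct_card by metis
  have ps: "partial_sum ?G as i = sum_list (take i as) mod int p" if "i \<le> card A" for i
    using that as(2) A len p(1) by (intro partial_sum_mod) auto
  have neq: "partial_sum ?G as i \<noteq> partial_sum ?G as j" if ij: "i < j" "j \<le> card A" "j - i \<le> t" for i j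
  proof
    assume "partial_sum ?G as i = partial_sum ?G as j"
    then have "sum_list (take j as) mod int p = sum_list (take i as) mod int p"
      using ps ij by simp
    then have d: "int p dvd sum_list (take j as) - sum_list (take i as)" by (simp add: mod_eq_dvd_iff)
    let ?b = "take (j - i) (drop i as)"
    have t: "take j as = take i as @ ?b" using ij(1) by (metis le_add_diff_inverse less_imp_le take_add)
    then have db: "int p dvd sum_list ?b" using d by simp
    have lb: "length ?b = j - i" using ij len by simp
    have as_split: "as = take i as @ ?b @ drop j as" using t by (metis append_assoc append_take_drop_id)
    show False
    proof (cases "j - i = 1")
      case True
      then obtain x where x: "?b = [x]" using lb by (metis One_nat_def length_0_conv length_Suc_conv)
      then have "x \<in> A" using as(2) by (metis in_set_dropD in_set_takeD list.set_intros(1))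
      then show False using db x A mod_residue_eq(3)[of x "int p" x] by auto
    next
      case False
      \<comment> \<open>From j - i \<le> t, t \<le> 6 and t < card A the length is at most min 6
        (card A - 1), which is the bound on the right.\<close>
      then have "2 \<le> length ?b" "length ?b \<le> Suc (min 5 (card A - 2))"
        using ij card assms(2) lb by auto
      then show False using as(3) as_split db unfolding block_free_def by blast
    qed
  qed
  have "weak_sequencing ?G t A as"
    unfolding weak_sequencing_def
  proof (intro conjI as(1,2) ballI impI)
    fix i j assume *: "i \<in> {0..card A}" "j \<in> {0..card A}" "i \<noteq> j \<and> \<bar>int i - int j\<bar> \<le> int t"
    show "partial_sum ?G as i \<noteq> partial_sum ?G as j"
    proof (cases "i < j")
      case True
      then show ?thesis using * by (intro neq) auto
    next
      case False
      then show ?thesis using * by (intro neq[symmetric]) auto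
    qed
  qed
  then show "weak_sequenceable ?G t A" unfolding weak_sequenceable_def by blast
qed

end
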